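(* Let $a,b\in\mathbb{N}_0$ with $(a,b)\neq(0,0)$ be such that $a+b\equiv 0\pmod 2$. The following statements hold. (i) There is a rational constant $C_{a,b}$, depending only on $a$ and $b$, such that $$N^*(a,b;8n+a+3b)=C_{a,b}\,N(a,b;8n+a+3b)\quad\text{for all } n\in\mathbb{N}_0$$ if and only if $$(a,b)\in\{(0,2),(0,4),(0,6),(1,1),(1,3),(2,0),(3,1),(4,0),(6,0)\}.$$ (ii) Suppose $a+3b\equiv 0\pmod 4$. There is a rational constant $\widetilde{C}_{a,b}$, depending only on $a$ and $b$, such that $$N^*(a,b;8n+a+3b)=\widetilde{C}_{a,b}\,\widetilde{N}(a,b;8n+a+3b)\quad\text{for all } n\in\mathbb{N}_0$$ if and only if $$(a,b)\in\{(0,4),(0,8),(1,1),(1,5),(2,2),(4,0),(5,1),(8,0)\}.$$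
   Context: $\mathbb{N}_0=\{0,1,2,\dots\}$. For $a,b,m\in\mathbb{N}_0$ with $(a,b)\neq(0,0)$: - $N(a,b;m)$ is the number of $(x_1,\dots,x_a,y_1,\dots,y_b)\in\mathbb{Z}^{a+b}$ with $m=x_1^2+\cdots+x_a^2+3y_1^2+\cdots+3y_b^2$. - $N^*(a,b;m)$ is the number of such tuples in which all $x_i$ and $y_j$ are odd. - $\widetilde{N}(a,b;m)$ is the number of such tuples in which at least one of the $x_i$, $y_j$ is odd; equivalently $\widetilde{N}(a,b;m)=N(a,b;m)-N(a,b;m/4)$, where $N(a,b;r)=0$ if $r\notin\mathbb{N}_0$. *)

theory Defs
  imports Complex_Main
begin

definition reps :: "nat \<Rightarrow> nat \<Rightarrow> nat \<Rightarrow> (int list \<times> int list) set" where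
  "reps a b m = {(xs, ys). length xs = a \<and> length ys = b \<and>
     int m = (\<Sum>x\<leftarrow>xs. x\<^sup>2) + (\<Sum>y\<leftarrow>ys. 3 * y\<^sup>2)}"

definition N_rep :: "nat \<Rightarrow> nat \<Rightarrow> nat \<Rightarrow> nat" where
  "N_rep a b m = card (reps a b m)"

definition N_star :: "nat \<Rightarrow> nat \<Rightarrow> nat \<Rightarrow> nat" where
  "N_star a b m = card {(xs, ys) \<in> reps a b m. (\<forall>x\<in>set xs. odd x) \<and> (\<forall>y\<in>set ys. odd y)}"

definition N_tilde :: "nat \<Rightarrow> nat \<Rightarrow> nat \<Rightarrow> nat" where
  "N_tilde a b m = card {(xs, ys) \<in> reps a b m. (\<exists>x\<in>set xs. odd x) \<or> (\<exists>y\<in>set ys. odd y)}"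

text \<open>The set of representations is finite, so the cardinalities above are genuine counts.\<close>

lemma finite_reps: "finite (reps a b m)"
proof -
  have le: "\<bar>x\<bar> \<le> x\<^sup>2" for x :: int
    using self_le_power[of "\<bar>x\<bar>" 2] by (cases "x = 0") auto
  let ?I = "{- int m..int m}"
  let ?L = "\<lambda>k. {zs. set zs \<subseteq> ?I \<and> length zs = k}"
  have "(xs, ys) \<in> ?L a \<times> ?L b" if "(xs, ys) \<in> reps a b m" for xs ys
  proof -
    have eq: "int m = (\<Sum>x\<leftarrow>xs. x\<^sup>2) + (\<Sum>y\<leftarrow>ys. 3 * y\<^sup>2)"
      and len: "length xs = a" "length ys = b"
      using that by (auto simp: reps_def)
    have nonneg: "0 \<le> (\<Sum>x\<leftarrow>xs. x\<^sup>2)" "0 \<le> (\<Sum>y\<leftarrow>ys. 3 * y\<^sup>2)"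
      by (auto intro!: sum_list_nonneg)
    have "x \<in> ?I" if "x \<in> set xs" for x
    proof -
      have "x\<^sup>2 \<le> (\<Sum>x\<leftarrow>xs. x\<^sup>2)"
        using that by (intro member_le_sum_list) auto
      then show ?thesis using le[of x] eq nonneg by auto
    qed
    moreover have "y \<in> ?I" if "y \<in> set ys" for y
    proof -
      have "3 * y\<^sup>2 \<le> (\<Sum>y\<leftarrow>ys. 3 * y\<^sup>2)"
        using that by (intro member_le_sum_list) auto
      then show ?thesis using le[of y] eq nonneg zero_le_power2[of y] by auto
    qed
    ultimately show ?thesis using len by auto
  qed
  then have "reps a b m \<subseteq> ?L a \<times> ?L b" by (rule subrelI)
  moreover have "finite (?L a \<times> ?L b)"
    by (intro finite_cartesian_product finite_lists_length_eq) auto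
  ultimately show ?thesis by (rule finite_subset)
qed

end

theory Submission
  imports
    Defs
    "HOL-Analysis.FPS_Convergence"
    "HOL-Real_Asymp.Real_Asymp"
    "HOL-Number_Theory.Cong"
begin

text \<open>Write \<open>phi = E + O\<close> for the splitting of the theta series \<open>phi(q) = \<Sum> q^(n^2)\<close> into even and odd
  \<open>n\<close>, and \<open>E', O'\<close> for the same series in \<open>q^3\<close>. On the residue class of \<open>a + 3 b\<close> modulo 8, only the
  terms \<open>E^i O^(a-i) E'^j O'^(b-j)\<close> with \<open>i \<equiv> j (mod 4)\<close> of \<open>phi^a phi'^b\<close> contribute. Modulo series
  in \<open>q^8\<close> one has \<open>E^4 = O^4/2\<close> and \<open>E E' = O O'/2\<close>, so each of the patterns
  \<open>(i,j) = (0,0), (1,1), (4,0), (0,4)\<close> contributes a multiple of \<open>O^a O'^b\<close>. This proves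
  proportionality whenever no other pattern fits.

  Conversely, suppose that \<open>N_star = C N\<close> on the residue class from \<open>a + 3 b\<close> on. The residue class
  section \<open>D\<close> of \<open>O^a O'^b - C phi^a phi'^b\<close> is then a polynomial whose coefficients are \<open>- C N(m)\<close>
  for \<open>m < a + 3 b\<close>. As \<open>q\<close> tends to 1 from below, \<open>phi(-q)\<close> decays faster than any power of \<open>1 - q\<close>,
  by iterating \<open>phi(q) phi(-q) = phi(-q^2)^2\<close>. Hence \<open>D(q)\<close> is a constant times \<open>O^a O'^b\<close> up to
  such an error, which for a polynomial forces \<open>D(1) = 0\<close>. So no \<open>m < a + 3 b\<close> in the residue class is
  represented, which any further pattern contradicts. For \<open>N_tilde\<close>, the pattern \<open>(a,b)\<close> is left out
  throughout.\<close>

unbundle no vec_syntax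
unbundle fps_syntax

section \<open>Theta series and representation numbers\<close>

text \<open>The coefficients are complex because the series will be evaluated on the unit disc, at
  \<open>q\<close> times eighth roots of unity. Taking \<open>P\<close> to be true,
  \<open>even\<close> or \<open>odd\<close> gives \<open>phi\<close>, \<open>E\<close> and
  \<open>O\<close> of the overview, in the variable \<open>q^c\<close>.\<close>

definition theta :: "(int \<Rightarrow> bool) \<Rightarrow> nat \<Rightarrow> complex fps" where
  "theta P c = Abs_fps (\<lambda>n. of_nat (card {x. P x \<and> int c * x\<^sup>2 = int n}))"

lemma theta_nth: "theta P c $ n = of_nat (card {x. P x \<and> int c * x\<^sup>2 = int n})"
  by (simp add: theta_def)

definition qlists :: "(int \<Rightarrow> bool) \<Rightarrow> nat \<Rightarrow> nat \<Rightarrow> nat \<Rightarrow> int list set" where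
  "qlists P c a m = {xs. length xs = a \<and> (\<forall>x\<in>set xs. P x) \<and> (\<Sum>x\<leftarrow>xs. int c * x\<^sup>2) = int m}"

lemma finite_theta_fiber:
  assumes "c > 0"
  shows "finite {x. P x \<and> int c * x\<^sup>2 = int n}"
proof (rule finite_subset)
  show "{x. P x \<and> int c * x\<^sup>2 = int n} \<subseteq> {- int n..int n}"
  proof
    fix x assume "x \<in> {x. P x \<and> int c * x\<^sup>2 = int n}"
    then have "int c * x\<^sup>2 = int n" by simp
    moreover have "1 * x\<^sup>2 \<le> int c * x\<^sup>2"
      using assms by (intro mult_right_mono) auto
    moreover have "\<bar>x\<bar> \<le> x\<^sup>2"
      using self_le_power[of "\<bar>x\<bar>" 2] by (cases "x = 0") auto
    ultimately have "\<bar>x\<bar> \<le> int n" by linarith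
    then show "x \<in> {- int n..int n}" by auto
  qed
qed auto

lemma qlists_0: "qlists P c 0 m = (if m = 0 then {[]} else {})"
  by (auto simp: qlists_def)

lemma sum_list_mult_squares_nonneg: "0 \<le> (\<Sum>x\<leftarrow>xs. int c * x\<^sup>2)"
  by (induction xs) auto

text \<open>Sorting by the contribution \<open>i\<close> of the first entry gives the shape of a
  Cauchy product, so powers of \<open>theta\<close> can be read off by induction.\<close>

lemma qlists_Suc:
  "qlists P c (Suc a) m =
     (\<Union>i\<in>{0..m}. case_prod (#) ` ({x. P x \<and> int c * x\<^sup>2 = int i} \<times> qlists P c a (m - i)))"
  (is "?L = ?R")
proof (intro equalityI subsetI)
  fix xs assume "xs \<in> ?L"
  then obtain x ys where xs: "xs = x # ys" and len: "length ys = a" and P: "P x" "\<forall>y\<in>set ys. P y"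
    and s: "int c * x\<^sup>2 + (\<Sum>x\<leftarrow>ys. int c * x\<^sup>2) = int m"
    by (cases xs) (auto simp: qlists_def)
  define i where "i = nat (int c * x\<^sup>2)"
  have i: "int c * x\<^sup>2 = int i" by (simp add: i_def)
  have "i \<le> m" using s sum_list_mult_squares_nonneg[of c ys] i by linarith
  moreover have "ys \<in> qlists P c a (m - i)"
    using s i len P \<open>i \<le> m\<close> by (auto simp: qlists_def)
  ultimately show "xs \<in> ?R" using xs P i by force
qed (auto simp: qlists_def)

lemma finite_qlists: "c > 0 \<Longrightarrow> finite (qlists P c a m)"
  by (induction a arbitrary: m) (auto simp: qlists_0 qlists_Suc finite_theta_fiber)

lemma theta_power_nth:
  assumes "c > 0"
  shows "(theta P c ^ a) $ m = of_nat (card (qlists P c a m))"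
proof (induction a arbitrary: m)
  case 0
  then show ?case by (simp add: qlists_0)
next
  case (Suc a)
  let ?S = "\<lambda>i. {x. P x \<and> int c * x\<^sup>2 = int i}"
  have "card (qlists P c (Suc a) m) =
      (\<Sum>i=0..m. card (case_prod (#) ` (?S i \<times> qlists P c a (m - i))))"
    unfolding qlists_Suc using finite_theta_fiber[OF assms] finite_qlists[OF assms]
    by (intro card_UN_disjoint) auto
  also have "\<dots> = (\<Sum>i=0..m. card (?S i) * card (qlists P c a (m - i)))"
    by (intro sum.cong refl, subst card_image) (auto simp: inj_on_def card_cartesian_product)
  finally show ?case
    using Suc.IH by (simp add: fps_mult_nth theta_nth)
qed

lemma card_reps_eq_nth:
  "of_nat (card {(xs, ys) \<in> reps a b m. (\<forall>x\<in>set xs. P x) \<and> (\<forall>y\<in>set ys. P y)}) =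
     (theta P 1 ^ a * theta P 3 ^ b) $ m"
proof -
  have eq: "{(xs, ys) \<in> reps a b m. (\<forall>x\<in>set xs. P x) \<and> (\<forall>y\<in>set ys. P y)} =
      (\<Union>i\<in>{0..m}. qlists P 1 a i \<times> qlists P 3 b (m - i))" (is "?L = ?R")
  proof (intro equalityI subsetI)
    fix p assume p: "p \<in> ?L"
    obtain xs ys where [simp]: "p = (xs, ys)" by (cases p)
    define i where "i = nat (\<Sum>x\<leftarrow>xs. x\<^sup>2)"
    have i: "(\<Sum>x\<leftarrow>xs. x\<^sup>2) = int i"
      using sum_list_mult_squares_nonneg[of 1 xs] by (simp add: i_def)
    have "i \<le> m"
      using p i sum_list_mult_squares_nonneg[of 3 ys] by (auto simp: reps_def)
    then show "p \<in> ?R"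
      using p i by (auto simp: reps_def qlists_def intro!: bexI[of _ i])
  qed (auto simp: reps_def qlists_def)
  have "card ?L = (\<Sum>i=0..m. card (qlists P 1 a i \<times> qlists P 3 b (m - i)))"
    unfolding eq
  proof (intro card_UN_disjoint ballI impI)
    fix i j :: nat assume "i \<noteq> j"
    then have "qlists P 1 a i \<inter> qlists P 1 a j = {}" by (auto simp: qlists_def)
    then show "(qlists P 1 a i \<times> qlists P 3 b (m - i)) \<inter> (qlists P 1 a j \<times> qlists P 3 b (m - j)) = {}"
      by blast
  qed (simp_all add: finite_qlists)
  then show ?thesis
    by (simp add: fps_mult_nth theta_power_nth card_cartesian_product)
qed

abbreviation theta_all :: "nat \<Rightarrow> complex fps" where
  "theta_all \<equiv> theta (\<lambda>_. True)"

lemma N_rep_eq_nth: "of_nat (N_rep a b m) = (theta_all 1 ^ a * theta_all 3 ^ b) $ m"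
  using card_reps_eq_nth[of a b m "\<lambda>_. True"] by (simp add: N_rep_def)

lemma N_star_eq_nth: "of_nat (N_star a b m) = (theta odd 1 ^ a * theta odd 3 ^ b) $ m"
  using card_reps_eq_nth[of a b m odd] by (simp add: N_star_def)

text \<open>Tuples with an odd entry are the complement of the all-even tuples, whose series is the
  single product of even thetas.\<close>

lemma N_tilde_eq_nth:
  "of_nat (N_tilde a b m) =
     (theta_all 1 ^ a * theta_all 3 ^ b - theta even 1 ^ a * theta even 3 ^ b) $ m"
proof -
  define E where "E = {(xs, ys) \<in> reps a b m. (\<forall>x\<in>set xs. even x) \<and> (\<forall>y\<in>set ys. even y)}"
  have sub: "E \<subseteq> reps a b m" unfolding E_def by blast
  have "{(xs, ys) \<in> reps a b m. (\<exists>x\<in>set xs. odd x) \<or> (\<exists>y\<in>set ys. odd y)} = reps a b m - E"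
    unfolding E_def by blast
  then have "N_tilde a b m = card (reps a b m - E)" by (simp only: N_tilde_def)
  also have "\<dots> = card (reps a b m) - card E"
    using sub finite_reps by (intro card_Diff_subset) (auto dest: finite_subset)
  \<comment> \<open>The additive form is safe to cast to complex numbers, unlike truncated
    subtraction.\<close>
  finally have "N_tilde a b m + card E = N_rep a b m"
    using card_mono[OF finite_reps sub] by (simp only: N_rep_def)
  then have "of_nat (N_tilde a b m) + of_nat (card E) = (of_nat (N_rep a b m) :: complex)"
    by (metis of_nat_add)
  then show ?thesis
    unfolding E_def card_reps_eq_nth N_rep_eq_nth by (simp add: eq_diff_eq)
qed

lemma theta_all_split: "c > 0 \<Longrightarrow> theta_all c = theta even c + theta odd c"
proof (rule fps_ext)
  fix n assume c: "c > 0"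
  have "{x. int c * x\<^sup>2 = int n} =
      {x. even x \<and> int c * x\<^sup>2 = int n} \<union> {x. odd x \<and> int c * x\<^sup>2 = int n}"
    by auto
  then have "card {x. int c * x\<^sup>2 = int n} =
      card {x. even x \<and> int c * x\<^sup>2 = int n} + card {x. odd x \<and> int c * x\<^sup>2 = int n}"
    using finite_theta_fiber[OF c] by (simp, intro card_Un_disjoint) auto
  then show "theta_all c $ n = (theta even c + theta odd c) $ n"
    by (simp add: theta_def)
qed

section \<open>Series with exponents in one residue class\<close>

text \<open>For \<open>k > 0\<close> this says that \<open>F\<close> is \<open>q^r\<close> times a
  Laurent series in \<open>q^k\<close>; in particular 0 is supported in every class.\<close>

definition supported :: "nat \<Rightarrow> nat \<Rightarrow> complex fps \<Rightarrow> bool" where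
  "supported k r F \<longleftrightarrow> (\<forall>m. F $ m \<noteq> 0 \<longrightarrow> [m = r] (mod k))"

lemma supported_mult:
  assumes "supported k r F" "supported k s G"
  shows "supported k (r + s) (F * G)"
  unfolding supported_def
proof (intro allI impI)
  fix m assume "(F * G) $ m \<noteq> 0"
  then obtain i where "i \<le> m" "F $ i * G $ (m - i) \<noteq> 0"
    by (auto simp: fps_mult_nth elim!: sum.not_neutral_contains_not_neutral)
  then have "[i + (m - i) = r + s] (mod k)"
    using assms by (intro cong_add) (auto simp: supported_def)
  then show "[m = r + s] (mod k)" using \<open>i \<le> m\<close> by simp
qed

lemma supported_power: "supported k r F \<Longrightarrow> supported k (n * r) (F ^ n)"
proof (induction n)
  case 0
  then show ?case by (auto simp: supported_def)
next
  case (Suc n)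
  then show ?case using supported_mult by simp
qed

lemma supported_weaken: "supported k r F \<Longrightarrow> l dvd k \<Longrightarrow> supported l r F"
  by (auto simp: supported_def intro: cong_dvd_modulus_nat)

lemma theta_nonzeroE:
  assumes "theta P c $ m \<noteq> 0"
  obtains x where "P x" "int c * x\<^sup>2 = int m"
  using assms by (auto simp: theta_def card_eq_0_iff)

lemma odd_square_mod_8: "odd (x :: int) \<Longrightarrow> [x\<^sup>2 = 1] (mod 8)"
proof -
  assume "odd x"
  then obtain k where "x = 2 * k + 1" by (elim oddE)
  moreover have "even (k * (k + 1))" by simp
  then obtain l where "k * (k + 1) = 2 * l" by (elim evenE)
  ultimately have "x\<^sup>2 = 1 + 8 * l" by (simp add: power2_eq_square algebra_simps)
  then show ?thesis by (simp add: cong_def)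
qed

lemma supported_theta_odd: "supported 8 c (theta odd c)"
  unfolding supported_def
proof (intro allI impI)
  fix m assume "theta odd c $ m \<noteq> 0"
  then obtain x where x: "odd x" "int c * x\<^sup>2 = int m" by (elim theta_nonzeroE)
  have "[int c * x\<^sup>2 = int c * 1] (mod int 8)"
    using odd_square_mod_8[OF x(1)] by (intro cong_mult) auto
  then show "[m = c] (mod 8)" unfolding x(2) mult_1_right cong_int_iff by simp
qed

lemma supported_theta_even: "supported 4 0 (theta even c)"
  unfolding supported_def
proof (intro allI impI)
  fix m assume "theta even c $ m \<noteq> 0"
  then obtain x where x: "even x" "int c * x\<^sup>2 = int m" by (elim theta_nonzeroE)
  then obtain k where "x = 2 * k" by (elim evenE)
  then have "int m = int 4 * (int c * k\<^sup>2)" using x(2) by (simp add: power2_eq_square)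
  then have "int 4 dvd int m" by (rule dvdI)
  then show "[m = 0] (mod 4)" unfolding int_dvd_int_iff by (simp add: cong_0_iff)
qed

section \<open>Even and odd representations\<close>

definition quads :: "(int \<Rightarrow> bool) \<Rightarrow> nat \<Rightarrow> nat \<Rightarrow> (int \<times> int \<times> int \<times> int) set" where
  "quads P c m = {(x, y, z, w). P x \<and> P y \<and> P z \<and> P w \<and>
     int c * (x\<^sup>2 + y\<^sup>2 + z\<^sup>2 + w\<^sup>2) = int m}"

lemma qlists_4_eq: "qlists P c 4 m = (\<lambda>(x, y, z, w). [x, y, z, w]) ` quads P c m"
proof -
  have "xs \<in> (\<lambda>(x, y, z, w). [x, y, z, w]) ` quads P c m" if "xs \<in> qlists P c 4 m" for xs
  proof -
    from that have "length xs = Suc (Suc (Suc (Suc 0)))" by (simp add: qlists_def)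
    then obtain x y z w where "xs = [x, y, z, w]"
      by (auto simp: length_Suc_conv)
    then show ?thesis using that
      by (auto simp: qlists_def quads_def algebra_simps intro!: image_eqI[of _ _ "(x, y, z, w)"])
  qed
  then show ?thesis by (auto simp: qlists_def quads_def algebra_simps)
qed

lemma card_qlists_4: "card (qlists P c 4 m) = card (quads P c m)"
  unfolding qlists_4_eq by (intro card_image) (auto simp: inj_on_def)

lemma finite_quads: "c > 0 \<Longrightarrow> finite (quads P c m)"
  using finite_qlists[of c P 4 m] unfolding qlists_4_eq
  by (rule finite_imageD) (auto simp: inj_on_def)

text \<open>Half of a symmetric 4x4 Hadamard matrix. It is orthogonal and symmetric, hence a
  norm-preserving involution, and the divisions are exact when the coordinate sum is even.\<close>

definition half_hadamard :: "int \<times> int \<times> int \<times> int \<Rightarrow> int \<times> int \<times> int \<times> int" where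
  "half_hadamard = (\<lambda>(x, y, z, w).
     ((x + y + z + w) div 2, (x + y - z - w) div 2, (x - y + z - w) div 2, (x - y - z + w) div 2))"

lemma half_hadamardE:
  assumes "even (x + y + z + w :: int)"
  obtains s t u v where "half_hadamard (x, y, z, w) = (s, t, u, v)"
    "x + y + z + w = 2 * s" "x + y - z - w = 2 * t" "x - y + z - w = 2 * u" "x - y - z + w = 2 * v"
    "s + t + u + v = 2 * x" "s\<^sup>2 + t\<^sup>2 + u\<^sup>2 + v\<^sup>2 = x\<^sup>2 + y\<^sup>2 + z\<^sup>2 + w\<^sup>2"
    "half_hadamard (s, t, u, v) = (x, y, z, w)"
proof -
  obtain s where s: "x + y + z + w = 2 * s" using assms by (elim evenE)
  define t u v where tuv: "t = s - z - w" "u = s - y - w" "v = s - y - z"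
  have x: "x = 2 * s - y - z - w" using s by simp
  show ?thesis
  proof (rule that[of s t u v])
    show "half_hadamard (x, y, z, w) = (s, t, u, v)"
      by (simp add: half_hadamard_def tuv x)
    show "s\<^sup>2 + t\<^sup>2 + u\<^sup>2 + v\<^sup>2 = x\<^sup>2 + y\<^sup>2 + z\<^sup>2 + w\<^sup>2"
      unfolding tuv x by (simp add: power2_eq_square algebra_simps)
    show "half_hadamard (s, t, u, v) = (x, y, z, w)"
      by (simp add: half_hadamard_def tuv x)
  qed (auto simp: tuv x)
qed

text \<open>Under the involution \<open>half_hadamard\<close>, odd quadruples whose sum is divisible by 4 correspond to even quadruples; flipping the
  sign of the first entry exchanges them with the remaining odd quadruples.\<close>

lemma card_quads_odd:
  assumes "c > 0" "m mod 8 = 4"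
  shows "card (quads odd c m) = 2 * card (quads even c m)"
proof -
  define A where "A = {(x, y, z, w) \<in> quads odd c m. 4 dvd x + y + z + w}"
  define B where "B = {(x, y, z, w) \<in> quads odd c m. \<not> 4 dvd x + y + z + w}"
  have fin: "finite (quads odd c m)" by (rule finite_quads) fact
  have sub: "A \<subseteq> quads odd c m" "B \<subseteq> quads odd c m" by (auto simp: A_def B_def)
  have "card A = card B"
  proof (rule bij_betw_same_card)
    show "bij_betw (\<lambda>(x, y, z, w). (- x, y, z, w)) A B"
    proof (rule bij_betw_byWitness[where f' = "\<lambda>(x, y, z, w). (- x, y, z, w)"])
      show "(\<lambda>(x, y, z, w). (- x, y, z, w)) ` A \<subseteq> B"
      proof clarify
        fix x y z w assume *: "(x, y, z, w) \<in> A"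
        then have "odd x" "4 dvd x + y + z + w" by (auto simp: A_def quads_def)
        \<comment> \<open>The sum changes by \<open>2 * x\<close>, which is 2 modulo 4 for odd
          \<open>x\<close>.\<close>
        then have "\<not> 4 dvd - x + y + z + w" by presburger
        with * show "(- x, y, z, w) \<in> B" by (auto simp: A_def B_def quads_def)
      qed
      show "(\<lambda>(x, y, z, w). (- x, y, z, w)) ` B \<subseteq> A"
      proof clarify
        fix x y z w assume *: "(x, y, z, w) \<in> B"
        then have "odd x" "odd y" "odd z" "odd w" "\<not> 4 dvd x + y + z + w"
          by (auto simp: B_def quads_def)
        then have "4 dvd - x + y + z + w" by presburger
        with * show "(- x, y, z, w) \<in> A" by (auto simp: A_def B_def quads_def)
      qed
    qed auto
  qed
  moreover have "card A = card (quads even c m)"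
  proof (rule bij_betw_same_card)
    show "bij_betw half_hadamard A (quads even c m)"
    proof (rule bij_betw_byWitness[where f' = half_hadamard])
      show "\<forall>p\<in>A. half_hadamard (half_hadamard p) = p"
      proof clarify
        fix x y z w assume "(x, y, z, w) \<in> A"
        then have "even (x + y + z + w)" by (auto simp: A_def quads_def)
        then show "half_hadamard (half_hadamard (x, y, z, w)) = (x, y, z, w)"
          by (elim half_hadamardE) simp
      qed
      show "\<forall>p\<in>quads even c m. half_hadamard (half_hadamard p) = p"
      proof clarify
        fix x y z w assume "(x, y, z, w) \<in> quads even c m"
        then have "even (x + y + z + w)" by (auto simp: quads_def)
        then show "half_hadamard (half_hadamard (x, y, z, w)) = (x, y, z, w)"
          by (elim half_hadamardE) simp
      qed
      show "half_hadamard ` A \<subseteq> quads even c m"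
      proof (rule image_subsetI)
        fix p assume p: "p \<in> A"
        obtain x y z w where xyzw: "p = (x, y, z, w)" by (cases p)
        from p have q: "odd x" "odd y" "odd z" "odd w" "4 dvd x + y + z + w"
          "int c * (x\<^sup>2 + y\<^sup>2 + z\<^sup>2 + w\<^sup>2) = int m"
          by (auto simp: xyzw A_def quads_def)
        then have "even (x + y + z + w)" by auto
        then obtain s t u v where h: "half_hadamard (x, y, z, w) = (s, t, u, v)" and e: "x + y + z + w = 2 * s" "x + y - z - w = 2 * t" "x - y + z - w = 2 * u"
          "x - y - z + w = 2 * v" "s\<^sup>2 + t\<^sup>2 + u\<^sup>2 + v\<^sup>2 = x\<^sup>2 + y\<^sup>2 + z\<^sup>2 + w\<^sup>2"
          by (elim half_hadamardE)
        \<comment> \<open>\<open>s\<close> is half of a multiple of 4, and each other coordinate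
          differs from \<open>s\<close> by a sum of two odd numbers, so all four are even.\<close>
        have "even s" using q(5) e(1) by presburger
        moreover have "t = s - z - w" "u = s - y - w" "v = s - y - z" using e by auto
        ultimately have "(s, t, u, v) \<in> quads even c m"
          using q e(5) by (simp add: quads_def)
        then show "half_hadamard p \<in> quads even c m" by (simp add: xyzw h)
      qed
      show "half_hadamard ` quads even c m \<subseteq> A"
      proof (rule image_subsetI)
        fix p assume p: "p \<in> quads even c m"
        obtain x y z w where xyzw: "p = (x, y, z, w)" by (cases p)
        from p have q: "even x" "even y" "even z" "even w"
          "int c * (x\<^sup>2 + y\<^sup>2 + z\<^sup>2 + w\<^sup>2) = int m"
          by (auto simp: xyzw quads_def)
        then have "even (x + y + z + w)" by auto
        then obtain s t u v where h: "half_hadamard (x, y, z, w) = (s, t, u, v)" and e: "x + y + z + w = 2 * s" "x + y - z - w = 2 * t" "x - y + z - w = 2 * u"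
          "x - y - z + w = 2 * v" "s\<^sup>2 + t\<^sup>2 + u\<^sup>2 + v\<^sup>2 = x\<^sup>2 + y\<^sup>2 + z\<^sup>2 + w\<^sup>2"
          "s + t + u + v = 2 * x"
          by (elim half_hadamardE)
        obtain x' y' z' w' where d: "x = 2 * x'" "y = 2 * y'" "z = 2 * z'" "w = 2 * w'"
          using q by (elim evenE)
        \<comment> \<open>Since \<open>m\<close> is 4 modulo 8, the halved entries have an odd sum
          of squares and hence an odd sum. The image consists of signed sums of these halved
          entries, so all its coordinates are odd.\<close>
        have "int m = 8 * int (m div 8) + 4" using assms by presburger
        moreover have "int m = 4 * (int c * (x'\<^sup>2 + y'\<^sup>2 + z'\<^sup>2 + w'\<^sup>2))"
          using q(5) by (simp add: d algebra_simps)
        ultimately have "int c * (x'\<^sup>2 + y'\<^sup>2 + z'\<^sup>2 + w'\<^sup>2) = 2 * int (m div 8) + 1"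
          by presburger
        then have "odd (int c * (x'\<^sup>2 + y'\<^sup>2 + z'\<^sup>2 + w'\<^sup>2))" by simp
        then have "odd (x' + y' + z' + w')" by simp
        moreover have "s = x' + y' + z' + w'" "t = x' + y' - z' - w'" "u = x' - y' + z' - w'"
          "v = x' - y' - z' + w'" using e d by auto
        moreover have "4 dvd s + t + u + v" unfolding e(6) d by simp
        ultimately have "(s, t, u, v) \<in> A" using e(5) q(5) by (simp add: A_def quads_def)
        then show "half_hadamard p \<in> A" by (simp add: xyzw h)
      qed
    qed
  qed
  moreover have "quads odd c m = A \<union> B" "A \<inter> B = {}" by (auto simp: A_def B_def)
  then have "card (quads odd c m) = card A + card B"
    using sub fin by (metis card_Un_disjoint finite_subset)
  ultimately show ?thesis by simp
qed

text \<open>All exponents in either fourth power are divisible by 4, and at exponents 4 modulo 8 the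
  two terms cancel by \<open>card_quads_odd\<close>. This is the relation between \<open>E^4\<close>
  and \<open>O^4\<close> modulo series in \<open>q^8\<close>.\<close>

lemma supported_theta_even_power_4:
  assumes "odd c"
  shows "supported 8 0 (theta even c ^ 4 - fps_const (1/2) * theta odd c ^ 4)"
  unfolding supported_def
proof (intro allI impI)
  fix m assume nz: "(theta even c ^ 4 - fps_const (1/2) * theta odd c ^ 4) $ m \<noteq> 0"
  have c: "c > 0" using assms by (cases c) auto
  have "theta even c ^ 4 $ m \<noteq> 0 \<or> theta odd c ^ 4 $ m \<noteq> 0" using nz by auto
  then have "[m = 4 * 0] (mod 4) \<or> [m = 4 * c] (mod 4)"
    using supported_power[OF supported_theta_even, of 4 c]
      supported_power[OF supported_weaken[OF supported_theta_odd, of 4 c], of 4]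
    by (auto simp: supported_def)
  then have "m mod 4 = 0" by (auto simp: cong_def)
  moreover have "m mod 8 \<noteq> 4"
  proof
    assume "m mod 8 = 4"
    then have "theta odd c ^ 4 $ m = 2 * theta even c ^ 4 $ m"
      using card_quads_odd[OF c] by (simp add: theta_power_nth[OF c] card_qlists_4)
    then show False using nz by simp
  qed
  ultimately show "[m = 0] (mod 8)" unfolding cong_def by presburger
qed

section \<open>The binary form x^2 + 3 y^2\<close>

definition pairs3 :: "(int \<Rightarrow> bool) \<Rightarrow> nat \<Rightarrow> (int \<times> int) set" where
  "pairs3 P m = {(x, y). P x \<and> P y \<and> x\<^sup>2 + 3 * y\<^sup>2 = int m}"

lemma card_pairs3: "(theta P 1 * theta P 3) $ m = of_nat (card (pairs3 P m))"
proof -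
  have "{(xs, ys) \<in> reps 1 1 m. (\<forall>x\<in>set xs. P x) \<and> (\<forall>y\<in>set ys. P y)} =
      (\<lambda>(x, y). ([x], [y])) ` pairs3 P m"
    by (auto simp: reps_def pairs3_def length_Suc_conv image_iff)
  then have "(theta P 1 ^ 1 * theta P 3 ^ 1) $ m = of_nat (card ((\<lambda>(x, y). ([x], [y])) ` pairs3 P m))"
    using card_reps_eq_nth[of 1 1 m P] by simp
  also have "card ((\<lambda>(x, y). ([x], [y])) ` pairs3 P m) = card (pairs3 P m)"
    by (intro card_image) (auto simp: inj_on_def)
  finally show ?thesis by simp
qed

text \<open>On \<open>x + y sqrt(-3)\<close> this is conjugation followed by multiplication by the
  sixth root of unity \<open>(1 + sqrt(-3)) / 2\<close>: a reflection, so a norm-preserving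
  involution, integral when \<open>x\<close> and \<open>y\<close> have the same parity.\<close>

definition rotate3 :: "int \<times> int \<Rightarrow> int \<times> int" where
  "rotate3 = (\<lambda>(x, y). ((x + 3 * y) div 2, (x - y) div 2))"

lemma rotate3E:
  assumes "even (x + y :: int)"
  obtains s t where "rotate3 (x, y) = (s, t)" "x + 3 * y = 2 * s" "x - y = 2 * t"
    "s\<^sup>2 + 3 * t\<^sup>2 = x\<^sup>2 + 3 * y\<^sup>2" "rotate3 (s, t) = (x, y)"
proof -
  have "even (x - y)" using assms by simp
  then obtain t where "x - y = 2 * t" by (elim evenE)
  then have x: "x = y + 2 * t" by simp
  show ?thesis
    by (rule that[of "2 * y + t" t])
      (simp_all add: rotate3_def x, simp add: power2_eq_square algebra_simps)
qed

text \<open>The scheme is that of \<open>card_quads_odd\<close>: \<open>rotate3\<close> matches the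
  even pairs with the odd pairs satisfying \<open>4 dvd x + 3 * y\<close>, and the sign change of
  \<open>x\<close> exchanges these with the other odd pairs.\<close>

lemma card_pairs3_odd:
  assumes "m mod 8 = 4"
  shows "card (pairs3 odd m) = 2 * card (pairs3 even m)"
proof -
  define A where "A = {(x, y) \<in> pairs3 odd m. 4 dvd x + 3 * y}"
  define B where "B = {(x, y) \<in> pairs3 odd m. \<not> 4 dvd x + 3 * y}"
  have "card A = card B"
  proof (rule bij_betw_same_card)
    show "bij_betw (\<lambda>(x, y). (- x, y)) A B"
    proof (rule bij_betw_byWitness[where f' = "\<lambda>(x, y). (- x, y)"])
      show "(\<lambda>(x, y). (- x, y)) ` A \<subseteq> B"
      proof clarify
        fix x y assume *: "(x, y) \<in> A"
        then have "odd x" "4 dvd x + 3 * y" by (auto simp: A_def pairs3_def)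
        then have "\<not> 4 dvd - x + 3 * y" by presburger
        with * show "(- x, y) \<in> B" by (auto simp: A_def B_def pairs3_def)
      qed
      show "(\<lambda>(x, y). (- x, y)) ` B \<subseteq> A"
      proof clarify
        fix x y assume *: "(x, y) \<in> B"
        then have "odd x" "odd y" "\<not> 4 dvd x + 3 * y" by (auto simp: B_def pairs3_def)
        then have "4 dvd - x + 3 * y" by presburger
        with * show "(- x, y) \<in> A" by (auto simp: A_def B_def pairs3_def)
      qed
    qed auto
  qed
  moreover have "card A = card (pairs3 even m)"
  proof (rule bij_betw_same_card)
    show "bij_betw rotate3 A (pairs3 even m)"
    proof (rule bij_betw_byWitness[where f' = rotate3])
      show "\<forall>p\<in>A. rotate3 (rotate3 p) = p"
      proof clarify
        fix x y assume "(x, y) \<in> A"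
        then have "even (x + y)" by (auto simp: A_def pairs3_def)
        then show "rotate3 (rotate3 (x, y)) = (x, y)" by (elim rotate3E) simp
      qed
      show "\<forall>p\<in>pairs3 even m. rotate3 (rotate3 p) = p"
      proof clarify
        fix x y assume "(x, y) \<in> pairs3 even m"
        then have "even (x + y)" by (auto simp: pairs3_def)
        then show "rotate3 (rotate3 (x, y)) = (x, y)" by (elim rotate3E) simp
      qed
      show "rotate3 ` A \<subseteq> pairs3 even m"
      proof (rule image_subsetI)
        fix p assume p: "p \<in> A"
        obtain x y where xy: "p = (x, y)" by (cases p)
        from p have q: "odd x" "odd y" "4 dvd x + 3 * y" "x\<^sup>2 + 3 * y\<^sup>2 = int m"
          by (auto simp: xy A_def pairs3_def)
        then have "even (x + y)" by auto
        then obtain s t where h: "rotate3 (x, y) = (s, t)" and e: "x + 3 * y = 2 * s" "x - y = 2 * t" "s\<^sup>2 + 3 * t\<^sup>2 = x\<^sup>2 + 3 * y\<^sup>2"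
          by (elim rotate3E)
        have "even s" using q(3) e(1) by presburger
        \<comment> \<open>\<open>x - y\<close> differs from \<open>x + 3 * y\<close> by
          \<open>4 * y\<close>, so it is divisible by 4 as well.\<close>
        moreover have "even t" using q(3) e(1,2) by presburger
        ultimately have "(s, t) \<in> pairs3 even m" using q e(3) by (simp add: pairs3_def)
        then show "rotate3 p \<in> pairs3 even m" by (simp add: xy h)
      qed
      show "rotate3 ` pairs3 even m \<subseteq> A"
      proof (rule image_subsetI)
        fix p assume p: "p \<in> pairs3 even m"
        obtain x y where xy: "p = (x, y)" by (cases p)
        from p have q: "even x" "even y" "x\<^sup>2 + 3 * y\<^sup>2 = int m" by (auto simp: xy pairs3_def)
        then have "even (x + y)" by auto
        then obtain s t where h: "rotate3 (x, y) = (s, t)" and e: "x + 3 * y = 2 * s" "x - y = 2 * t" "s\<^sup>2 + 3 * t\<^sup>2 = x\<^sup>2 + 3 * y\<^sup>2"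
          by (elim rotate3E)
        obtain x' y' where d: "x = 2 * x'" "y = 2 * y'" using q by (elim evenE)
        \<comment> \<open>As \<open>m\<close> is 4 modulo 8, \<open>x'\<close> and \<open>y'\<close>
          have opposite parity, which makes \<open>s\<close> and \<open>t\<close> odd; moreover
          \<open>s + 3 * t = 4 * x'\<close>.\<close>
        have "int m = 8 * int (m div 8) + 4" using assms by presburger
        moreover have "int m = 4 * (x'\<^sup>2 + 3 * y'\<^sup>2)" using q(3) by (simp add: d algebra_simps)
        ultimately have "x'\<^sup>2 + 3 * y'\<^sup>2 = 2 * int (m div 8) + 1" by presburger
        then have "odd (x'\<^sup>2 + 3 * y'\<^sup>2)" by simp
        then have "odd (x' + y')" by simp
        moreover have "s = x' + 3 * y'" "t = x' - y'" using e d by auto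
        ultimately have "odd s" "odd t" "4 dvd s + 3 * t" by simp_all
        with e(3) q(3) have "(s, t) \<in> A" by (simp add: A_def pairs3_def)
        then show "rotate3 p \<in> A" by (simp add: xy h)
      qed
    qed
  qed
  moreover have "finite (pairs3 odd m)"
  proof (rule finite_subset)
    have le: "\<bar>x\<bar> \<le> x\<^sup>2" for x :: int
      using self_le_power[of "\<bar>x\<bar>" 2] by (cases "x = 0") auto
    have "x \<in> {- int m..int m} \<and> y \<in> {- int m..int m}" if "x\<^sup>2 + 3 * y\<^sup>2 = int m" for x y
    proof -
      have "\<bar>x\<bar> \<le> int m" "\<bar>y\<bar> \<le> int m"
        using that le[of x] le[of y] zero_le_power2[of x] zero_le_power2[of y] by linarith+
      then show ?thesis by auto
    qed
    then show "pairs3 odd m \<subseteq> {- int m..int m} \<times> {- int m..int m}"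
      by (auto simp: pairs3_def)
  qed auto
  moreover have "pairs3 odd m = A \<union> B" "A \<inter> B = {}" by (auto simp: A_def B_def)
  ultimately have "card (pairs3 odd m) = card A + card B"
    by (metis card_Un_disjoint finite_Un)
  with \<open>card A = card B\<close> \<open>card A = card (pairs3 even m)\<close> show ?thesis by simp
qed

text \<open>Exponents of both products are divisible by 4, and \<open>card_pairs3_odd\<close>
  cancels those that are 4 modulo 8.\<close>

lemma supported_theta_even_pair:
  "supported 8 0 (theta even 1 * theta even 3 - fps_const (1/2) * (theta odd 1 * theta odd 3))"
  unfolding supported_def
proof (intro allI impI)
  fix m assume nz:
    "(theta even 1 * theta even 3 - fps_const (1/2) * (theta odd 1 * theta odd 3)) $ m \<noteq> 0"
  have "(theta even 1 * theta even 3) $ m \<noteq> 0 \<or> (theta odd 1 * theta odd 3) $ m \<noteq> 0"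
    using nz by auto
  then have "[m = 0 + 0] (mod 4) \<or> [m = 1 + 3] (mod 4)"
    using supported_mult[OF supported_theta_even supported_theta_even, of 1 3]
      supported_mult[OF supported_weaken[OF supported_theta_odd, of 4 1]
        supported_weaken[OF supported_theta_odd, of 4 3]]
    by (auto simp: supported_def)
  then have "m mod 4 = 0" by (auto simp: cong_def)
  moreover have "m mod 8 \<noteq> 4"
  proof
    assume "m mod 8 = 4"
    then have "(theta odd 1 * theta odd 3) $ m = 2 * (theta even 1 * theta even 3) $ m"
      using card_pairs3_odd by (simp only: card_pairs3) simp
    then show False using nz by simp
  qed
  ultimately show "[m = 0] (mod 8)" unfolding cong_def by presburger
qed

section \<open>Parity patterns\<close>

text \<open>The pairs \<open>(i, j)\<close> count even entries in fixed positions; the choice of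
  positions enters as binomial coefficients in \<open>theta_all_product_nth\<close>. The even
  factors are kept together so that they can be replaced as a block.\<close>

definition pattern_fps :: "nat \<Rightarrow> nat \<Rightarrow> nat \<times> nat \<Rightarrow> complex fps" where
  "pattern_fps a b = (\<lambda>(i, j). (theta even 1 ^ i * theta even 3 ^ j) *
     (theta odd 1 ^ (a - i) * theta odd 3 ^ (b - j)))"

lemma fps_nth_of_nat_mult: "(of_nat n * F :: complex fps) $ m = of_nat n * F $ m"
  by (simp flip: fps_of_nat)

lemma theta_all_product_nth:
  "(theta_all 1 ^ a * theta_all 3 ^ b) $ m =
     (\<Sum>p\<in>{..a} \<times> {..b}. of_nat ((a choose fst p) * (b choose snd p)) * pattern_fps a b p $ m)"
proof -
  have "theta_all 1 ^ a * theta_all 3 ^ b =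
      (\<Sum>i\<le>a. of_nat (a choose i) * theta even 1 ^ i * theta odd 1 ^ (a - i)) *
      (\<Sum>j\<le>b. of_nat (b choose j) * theta even 3 ^ j * theta odd 3 ^ (b - j))"
    by (simp add: theta_all_split binomial_ring)
  also have "\<dots> = (\<Sum>(i, j)\<in>{..a} \<times> {..b}.
      of_nat (a choose i) * theta even 1 ^ i * theta odd 1 ^ (a - i) *
      (of_nat (b choose j) * theta even 3 ^ j * theta odd 3 ^ (b - j)))"
    by (simp add: sum_product sum.cartesian_product)
  also have "\<dots> = (\<Sum>p\<in>{..a} \<times> {..b}.
      of_nat ((a choose fst p) * (b choose snd p)) * pattern_fps a b p)"
    by (intro sum.cong) (auto simp: pattern_fps_def ac_simps)
  finally show ?thesis by (simp add: fps_sum_nth fps_nth_of_nat_mult del: of_nat_mult)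
qed

lemma supported_odd_product: "supported 8 (a + 3 * b) (theta odd 1 ^ a * theta odd 3 ^ b)"
  using supported_mult[OF supported_power[OF supported_theta_odd[of 1]]
      supported_power[OF supported_theta_odd[of 3]], of a b]
  by (simp add: mult.commute)

text \<open>Even squares vanish modulo 4, so the exponents of the pattern are
  \<open>a - i + 3 * (b - j)\<close> modulo 4. They can meet the class of \<open>a + 3 * b\<close>
  only if \<open>i + 3 * j\<close>, that is \<open>i - j\<close>, is divisible by 4.\<close>

lemma pattern_nth_eq_0:
  assumes "i \<le> a" "j \<le> b" "[m = a + 3 * b] (mod 8)" "\<not> [i = j] (mod 4)"
  shows "pattern_fps a b (i, j) $ m = 0"
proof (rule ccontr)
  assume nz: "pattern_fps a b (i, j) $ m \<noteq> 0"
  have "supported 4 (i * 0 + j * 0) (theta even 1 ^ i * theta even 3 ^ j)"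
    by (intro supported_mult supported_power supported_theta_even)
  moreover have "supported 4 (a - i + 3 * (b - j)) (theta odd 1 ^ (a - i) * theta odd 3 ^ (b - j))"
    by (rule supported_weaken[OF supported_odd_product]) simp
  ultimately have "supported 4 (a - i + 3 * (b - j)) (pattern_fps a b (i, j))"
    using supported_mult by (fastforce simp: pattern_fps_def)
  with nz have "[m = a - i + 3 * (b - j)] (mod 4)" by (auto simp: supported_def)
  moreover have "[m = a + 3 * b] (mod 4)"
    using assms(3) by (rule cong_dvd_modulus_nat) simp
  moreover have "a + 3 * b = (a - i + 3 * (b - j)) + (i + 3 * j)" using assms by simp
  ultimately have "[a - i + 3 * (b - j) + (i + 3 * j) = a - i + 3 * (b - j) + 0] (mod 4)"
    by (metis cong_sym cong_trans add.right_neutral)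
  then have "[i + 3 * j = 0] (mod 4)" by (simp only: cong_add_lcancel_nat)
  then have "[i + 3 * j + j = 0 + j] (mod 4)" by (rule cong_add) simp
  moreover have "i + 3 * j + j = i + 4 * j" by simp
  ultimately have "[i = j] (mod 4)" by (simp add: cong_def)
  with assms(4) show False by simp
qed

text \<open>Multiplying the difference \<open>F - G/2\<close> by \<open>H\<close> leaves only
  exponents congruent to \<open>r\<close>, so nothing survives in the class of
  \<open>r + 4\<close>.\<close>

lemma half_on_residue:
  assumes "supported 8 0 (F - fps_const (1/2) * G)" "supported 8 r H" "[m = r + 4] (mod 8)"
  shows "2 * (F * H) $ m = (G * H) $ m"
proof -
  have "supported 8 (0 + r) ((F - fps_const (1/2) * G) * H)"
    using assms(1,2) by (rule supported_mult)
  moreover have "\<not> [m = 0 + r] (mod 8)"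
  proof
    assume "[m = 0 + r] (mod 8)"
    then have "[r + 4 = r + 0] (mod 8)"
      using assms(3) by (metis add_0 add_0_right cong_sym cong_trans)
    then have "[4 = 0 :: nat] (mod 8)" by (simp only: cong_add_lcancel_nat)
    then show False by (simp add: cong_def)
  qed
  ultimately have "((F - fps_const (1/2) * G) * H) $ m = 0"
    unfolding supported_def by blast
  then have "(F * H) $ m = 1/2 * (G * H) $ m"
    by (simp add: left_diff_distrib mult.assoc)
  then show ?thesis by (simp only:) simp
qed

text \<open>For these three pairs \<open>i + 3 * j\<close> is 4 or 12, so \<open>m\<close> lies 4
  modulo 8 away from the class of the odd cofactor, and the even block may be traded for half of the
  corresponding odd block.\<close>

lemma pattern_nth_half:
  assumes "i \<le> a" "j \<le> b" "[m = a + 3 * b] (mod 8)" "(i, j) \<in> {(1, 1), (4, 0), (0, 4)}"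
  shows "2 * pattern_fps a b (i, j) $ m = (theta odd 1 ^ a * theta odd 3 ^ b) $ m"
proof -
  let ?H = "theta odd 1 ^ (a - i) * theta odd 3 ^ (b - j)"
  have sup: "supported 8 0 (theta even 1 ^ i * theta even 3 ^ j -
      fps_const (1/2) * (theta odd 1 ^ i * theta odd 3 ^ j))"
    using assms(4) supported_theta_even_pair supported_theta_even_power_4[of 1]
      supported_theta_even_power_4[of 3] by auto
  have "[i + 3 * j = 4] (mod 8)" using assms(4) by (auto simp: cong_def)
  then have "[a - i + 3 * (b - j) + (i + 3 * j) = a - i + 3 * (b - j) + 4] (mod 8)"
    by (intro cong_add cong_refl)
  moreover have "a - i + 3 * (b - j) + (i + 3 * j) = a + 3 * b" using assms by simp
  ultimately have "[m = a - i + 3 * (b - j) + 4] (mod 8)"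
    using cong_trans[OF assms(3)] by (simp only:)
  then have "2 * pattern_fps a b (i, j) $ m = (theta odd 1 ^ i * theta odd 3 ^ j * ?H) $ m"
    unfolding pattern_fps_def prod.case by (intro half_on_residue[OF sup supported_odd_product])
  also have "theta odd 1 ^ i * theta odd 3 ^ j * ?H =
      (theta odd 1 ^ i * theta odd 1 ^ (a - i)) * (theta odd 3 ^ j * theta odd 3 ^ (b - j))"
    by (simp add: ac_simps)
  also have "\<dots> = theta odd 1 ^ a * theta odd 3 ^ b"
    using assms(1,2) by (simp flip: power_add)
  finally show ?thesis .
qed

text \<open>The set \<open>S\<close> is left variable because \<open>N_rep\<close> uses all patterns
  while \<open>N_tilde\<close> omits \<open>(a, b)\<close>. The factor 2 clears the halves, so that
  the multiplier is a natural number.\<close>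

lemma pattern_sum:
  assumes "S \<subseteq> {..a} \<times> {..b}" "(0, 0) \<in> S"
    and good: "\<And>i j. (i, j) \<in> S \<Longrightarrow> [i = j] (mod 4) \<Longrightarrow>
      (i, j) \<in> {(0, 0), (1, 1), (4, 0), (0, 4)}"
  shows "\<exists>d::nat > 0. \<forall>m. [m = a + 3 * b] (mod 8) \<longrightarrow>
    2 * (\<Sum>p\<in>S. of_nat ((a choose fst p) * (b choose snd p)) * pattern_fps a b p $ m) =
    of_nat d * (theta odd 1 ^ a * theta odd 3 ^ b) $ m"
proof -
  \<comment> \<open>The multiplicity of \<open>O^a O'^b\<close> in twice each weighted pattern: 2
    for the all-odd one, the binomial weight for those equal to half of it, and 0 for those
    vanishing on the residue class.\<close>
  define w where "w = (\<lambda>p. if p = (0, 0) then 2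
    else if p \<in> {(1, 1), (4, 0), (0, 4)} then (a choose fst p) * (b choose snd p) else 0)"
  have fin: "finite S" using assms(1) by (rule finite_subset) simp
  have "2 * (of_nat ((a choose fst p) * (b choose snd p)) * pattern_fps a b p $ m) =
      of_nat (w p) * (theta odd 1 ^ a * theta odd 3 ^ b) $ m"
    if "p \<in> S" "[m = a + 3 * b] (mod 8)" for p m
  proof -
    obtain i j where p: "p = (i, j)" by (cases p)
    have ij: "i \<le> a" "j \<le> b" using that assms(1) p by auto
    have "\<not> [i = j] (mod 4)" if "p \<notin> {(0, 0), (1, 1), (4, 0), (0, 4)}"
      using good[of i j] \<open>p \<in> S\<close> that p by blast
    then consider "p = (0, 0)" | "p \<in> {(1, 1), (4, 0), (0, 4)}" "p \<noteq> (0, 0)"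
      | "\<not> [i = j] (mod 4)" "p \<notin> {(0, 0), (1, 1), (4, 0), (0, 4)}"
      by blast
    then show ?thesis
    proof cases
      case 1
      then show ?thesis by (simp add: w_def pattern_fps_def)
    next
      case 2
      then have "2 * pattern_fps a b p $ m = (theta odd 1 ^ a * theta odd 3 ^ b) $ m"
        unfolding p using pattern_nth_half ij that(2) by simp
      moreover have "w p = (a choose fst p) * (b choose snd p)"
        using 2 by (simp only: w_def if_False if_True)
      ultimately show ?thesis by (metis mult.left_commute)
    next
      case 3
      then have "w p = 0" by (auto simp: w_def)
      then show ?thesis using pattern_nth_eq_0[OF ij that(2) 3(1)] by (simp add: p)
    qed
  qed
  then have "\<forall>m. [m = a + 3 * b] (mod 8) \<longrightarrow>
    2 * (\<Sum>p\<in>S. of_nat ((a choose fst p) * (b choose snd p)) * pattern_fps a b p $ m) =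
    of_nat (\<Sum>p\<in>S. w p) * (theta odd 1 ^ a * theta odd 3 ^ b) $ m"
    unfolding sum_distrib_left of_nat_sum sum_distrib_right by (intro allI impI sum.cong refl) simp
  \<comment> \<open>The all-odd pattern alone contributes 2, so the multiplier is positive and can
    later be divided by.\<close>
  moreover have "w (0, 0) \<le> (\<Sum>p\<in>S. w p)" using fin assms(2) by (intro member_le_sum) auto
  then have "(\<Sum>p\<in>S. w p) > 0" by (simp add: w_def)
  ultimately show ?thesis by blast
qed

lemma rat_proportional:
  assumes "d > 0" and eq: "\<And>m. [m = a + 3 * b] (mod 8) \<Longrightarrow>
    2 * complex_of_nat (N m) = of_nat d * of_nat (M m)"
  shows "\<exists>C :: rat. \<forall>n. of_nat (M (8 * n + a + 3 * b)) = C * of_nat (N (8 * n + a + 3 * b))"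
proof -
  have "rat_of_nat (M (8 * n + a + 3 * b)) = 2 / of_nat d * of_nat (N (8 * n + a + 3 * b))" for n
  proof -
    have "complex_of_nat (2 * N (8 * n + a + 3 * b)) = of_nat (d * M (8 * n + a + 3 * b))"
      using eq[of "8 * n + a + 3 * b"] by (simp add: cong_def add.assoc)
    then have "2 * N (8 * n + a + 3 * b) = d * M (8 * n + a + 3 * b)"
      by (simp only: of_nat_eq_iff)
    then have "2 * rat_of_nat (N (8 * n + a + 3 * b)) = of_nat d * of_nat (M (8 * n + a + 3 * b))"
      by (metis of_nat_mult of_nat_numeral)
    then show ?thesis using \<open>d > 0\<close> by (simp add: field_simps)
  qed
  then show ?thesis by blast
qed

lemma N_star_proportional_N_rep:
  assumes "\<And>i j. i \<le> a \<Longrightarrow> j \<le> b \<Longrightarrow> [i = j] (mod 4) \<Longrightarrow>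
    (i, j) \<in> {(0, 0), (1, 1), (4, 0), (0, 4)}"
  shows "\<exists>C :: rat. \<forall>n :: nat.
    of_nat (N_star a b (8 * n + a + 3 * b)) = C * of_nat (N_rep a b (8 * n + a + 3 * b))"
proof -
  obtain d :: nat where "d > 0" and "[m = a + 3 * b] (mod 8) \<Longrightarrow>
      2 * complex_of_nat (N_rep a b m) = of_nat d * of_nat (N_star a b m)" for m
  proof -
    have "\<exists>d::nat > 0. \<forall>m. [m = a + 3 * b] (mod 8) \<longrightarrow>
        2 * complex_of_nat (N_rep a b m) = of_nat d * of_nat (N_star a b m)"
      unfolding theta_all_product_nth N_rep_eq_nth N_star_eq_nth
      using assms by (intro pattern_sum) auto
    then show thesis using that by blast
  qed
  then show ?thesis by (rule rat_proportional)
qed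

lemma N_star_proportional_N_tilde:
  assumes "(a, b) \<noteq> (0, 0)"
    and "\<And>i j. i \<le> a \<Longrightarrow> j \<le> b \<Longrightarrow> [i = j] (mod 4) \<Longrightarrow>
      (i, j) \<in> {(0, 0), (1, 1), (4, 0), (0, 4), (a, b)}"
  shows "\<exists>C :: rat. \<forall>n :: nat.
    of_nat (N_star a b (8 * n + a + 3 * b)) = C * of_nat (N_tilde a b (8 * n + a + 3 * b))"
proof -
  let ?S = "{..a} \<times> {..b} - {(a, b)}"
  \<comment> \<open>The subtracted all-even product is exactly the pattern \<open>(a, b)\<close>,
    which has binomial weight 1.\<close>
  have Nt: "(theta_all 1 ^ a * theta_all 3 ^ b - theta even 1 ^ a * theta even 3 ^ b) $ m =
      (\<Sum>p\<in>?S. of_nat ((a choose fst p) * (b choose snd p)) * pattern_fps a b p $ m)" for m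
    unfolding fps_sub_nth theta_all_product_nth
    by (subst sum.remove[of _ "(a, b)"]) (auto simp: pattern_fps_def)
  have "\<exists>d::nat > 0. \<forall>m. [m = a + 3 * b] (mod 8) \<longrightarrow>
      2 * complex_of_nat (N_tilde a b m) = of_nat d * of_nat (N_star a b m)"
    unfolding N_tilde_eq_nth N_star_eq_nth Nt
  proof (rule pattern_sum)
    show "(0, 0) \<in> ?S" using assms(1) by auto
    fix i j assume "(i, j) \<in> ?S" "[i = j] (mod 4)"
    then show "(i, j) \<in> {(0, 0), (1, 1), (4, 0), (0, 4)}" using assms(2)[of i j] by auto
  qed auto
  then obtain d :: nat where "d > 0" and "[m = a + 3 * b] (mod 8) \<Longrightarrow>
      2 * complex_of_nat (N_tilde a b m) = of_nat d * of_nat (N_star a b m)" for m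
    by blast
  then show ?thesis by (rule rat_proportional)
qed

section \<open>Theta functions on the unit disc\<close>

lemma fps_nth_theta_le:
  assumes "c > 0"
  shows "norm (theta P c $ n) \<le> 2"
proof (cases "{x. P x \<and> int c * x\<^sup>2 = int n} = {}")
  case True
  then show ?thesis by (simp only: theta_nth) simp
next
  case False
  then obtain k where k: "int c * k\<^sup>2 = int n" by blast
  have "{x. P x \<and> int c * x\<^sup>2 = int n} \<subseteq> {k, - k}"
  proof
    fix x assume "x \<in> {x. P x \<and> int c * x\<^sup>2 = int n}"
    then have "int c * x\<^sup>2 = int c * k\<^sup>2" using k by simp
    then have "x\<^sup>2 = k\<^sup>2" using assms by simp
    then show "x \<in> {k, - k}" by (simp add: power2_eq_iff)
  qed
  then have "card {x. P x \<and> int c * x\<^sup>2 = int n} \<le> card {k, - k}" by (intro card_mono) auto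
  also have "\<dots> \<le> 2" by (simp add: card_insert_if)
  finally show ?thesis by (simp add: theta_nth)
qed

lemma conv_radius_theta:
  assumes "c > 0"
  shows "fps_conv_radius (theta P c) \<ge> 1"
  unfolding fps_conv_radius_def
proof (rule conv_radius_geI_ex')
  fix r :: real assume r: "0 < r" "ereal r < 1"
  show "summable (\<lambda>n. theta P c $ n * of_real r ^ n)"
  proof (rule summable_comparison_test')
    show "summable (\<lambda>n. 2 * r ^ n)" using r by (intro summable_mult summable_geometric) auto
    show "norm (theta P c $ n * of_real r ^ n) \<le> 2 * r ^ n" if "n \<ge> 0" for n
      using fps_nth_theta_le[OF assms, of P n] r
      by (simp add: norm_mult norm_power mult_right_mono)
  qed
qed

lemma conv_radius_mult_ge: "fps_conv_radius F \<ge> R \<Longrightarrow> fps_conv_radius G \<ge> R \<Longrightarrow>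
    fps_conv_radius (F * G :: complex fps) \<ge> R"
  by (rule order_trans[OF _ fps_conv_radius_mult]) simp

lemma conv_radius_power_ge: "fps_conv_radius F \<ge> R \<Longrightarrow> fps_conv_radius (F ^ n :: complex fps) \<ge> R"
  by (rule order_trans[OF _ fps_conv_radius_power])

lemma conv_radius_diff_ge: "fps_conv_radius F \<ge> R \<Longrightarrow> fps_conv_radius G \<ge> R \<Longrightarrow>
    fps_conv_radius (F - G :: complex fps) \<ge> R"
  by (rule order_trans[OF _ fps_conv_radius_diff]) simp

lemmas conv_radius_ge_intros =
  conv_radius_theta conv_radius_mult_ge conv_radius_power_ge conv_radius_diff_ge

lemma norm_less_conv_radius: "norm z < 1 \<Longrightarrow> fps_conv_radius F \<ge> 1 \<Longrightarrow> ereal (norm z) < fps_conv_radius F"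
  by (metis less_ereal.simps(1) less_le_trans one_ereal_def)

section \<open>Substitution and rotation of the argument\<close>

lemma eval_fps_subst_power:
  fixes F G :: "complex fps"
  assumes "k > 0" "\<And>m. F $ (k * m) = G $ m" "\<And>m. \<not> k dvd m \<Longrightarrow> F $ m = 0"
  shows "eval_fps F z = eval_fps G (z ^ k)"
proof -
  have "(\<Sum>n. F $ n * z ^ n) = (\<Sum>n. F $ (k * n) * z ^ (k * n))"
  proof (rule suminf_mono_reindex[symmetric])
    show "strict_mono (\<lambda>n. k * n)" using assms(1) by (simp add: strict_mono_def)
    fix n assume "n \<notin> range (\<lambda>n. k * n)"
    then have "\<not> k dvd n" by (auto elim!: dvdE)
    then show "F $ n * z ^ n = 0" by (simp add: assms(3))
  qed
  then show ?thesis by (simp add: eval_fps_def assms(2) power_mult)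
qed

lemma eval_theta_even: "eval_fps (theta even c) z = eval_fps (theta_all c) (z ^ 4)"
proof (rule eval_fps_subst_power)
  fix m
  have "bij_betw (\<lambda>x. 2 * x) {x. int c * x\<^sup>2 = int m} {x. even x \<and> int c * x\<^sup>2 = int (4 * m)}"
    by (intro bij_betw_byWitness[where f' = "\<lambda>x. x div 2"]) (auto simp: power_mult_distrib)
  then show "theta even c $ (4 * m) = theta_all c $ m"
    by (simp add: theta_nth bij_betw_same_card del: of_nat_mult)
next
  show "theta even c $ m = 0" if "\<not> 4 dvd m" for m
    using supported_theta_even[of c] that by (auto simp: supported_def cong_0_iff)
qed simp

lemma eval_theta_3: "eval_fps (theta P 3) z = eval_fps (theta P 1) (z ^ 3)"
proof (rule eval_fps_subst_power)
  show "theta P 3 $ (3 * m) = theta P 1 $ m" for m by (simp add: theta_nth)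
  show "theta P 3 $ m = 0" if "\<not> 3 dvd m" for m
  proof (rule ccontr)
    assume "theta P 3 $ m \<noteq> 0"
    then obtain x where "int 3 * x\<^sup>2 = int m" by (elim theta_nonzeroE)
    then have "int 3 dvd int m" by (metis dvd_triv_left)
    then show False using that by (simp only: int_dvd_int_iff)
  qed
qed simp

text \<open>Powers of an eighth root of unity depend only on the exponent modulo 8, which is
  constant on the support of \<open>F\<close>.\<close>

lemma eval_fps_rotate:
  assumes "supported 8 r F" "\<zeta> ^ 8 = 1" "fps_conv_radius F \<ge> 1" "norm z < 1"
  shows "eval_fps F (\<zeta> * z) = \<zeta> ^ r * eval_fps F z"
proof -
  have "F $ n * (\<zeta> * z) ^ n = \<zeta> ^ r * (F $ n * z ^ n)" for n
  proof (cases "F $ n = 0")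
    case False
    then have "n mod 8 = r mod 8" using assms(1) by (auto simp: supported_def cong_def)
    moreover have "\<zeta> ^ k = \<zeta> ^ (k mod 8)" for k
    proof -
      have "\<zeta> ^ k = \<zeta> ^ (8 * (k div 8) + k mod 8)" by simp
      also have "\<dots> = \<zeta> ^ (k mod 8)" unfolding power_add power_mult assms(2) by simp
      finally show ?thesis .
    qed
    ultimately have "\<zeta> ^ n = \<zeta> ^ r" by metis
    then show ?thesis by (simp add: power_mult_distrib)
  qed simp
  moreover have "summable (\<lambda>n. F $ n * z ^ n)"
    using assms by (intro summable_fps norm_less_conv_radius)
  ultimately show ?thesis unfolding eval_fps_def by (simp only: suminf_mult)
qed

abbreviation phi :: "complex \<Rightarrow> complex" where "phi \<equiv> eval_fps (theta_all 1)"

abbreviation psi :: "complex \<Rightarrow> complex" where "psi \<equiv> eval_fps (theta odd 1)"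

lemma phi_split:
  assumes "norm z < 1"
  shows "phi z = phi (z ^ 4) + psi z"
proof -
  have "phi z = eval_fps (theta even 1 + theta odd 1) z"
    by (simp only: theta_all_split[OF zero_less_one])
  also have "\<dots> = eval_fps (theta even 1) z + psi z"
    using assms by (intro eval_fps_add norm_less_conv_radius conv_radius_theta) auto
  finally show ?thesis by (simp only: eval_theta_even)
qed

lemma norm_root_of_unity: "\<zeta> ^ n = 1 \<Longrightarrow> n > 0 \<Longrightarrow> norm (\<zeta> :: complex) = 1"
  using power_eq_imp_eq_norm[of \<zeta> n 1] by simp

text \<open>The even part is a function of the fourth power of its argument, while the odd part has
  exponents 1 modulo 8 and just picks up \<zeta>. The case of -1 gives
  \<open>phi (- z) = phi (z ^ 4) - psi z\<close>.\<close>

lemma phi_rotate: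
  assumes "norm z < 1" "\<zeta> ^ 8 = 1"
  shows "phi (\<zeta> * z) = phi (\<zeta> ^ 4 * z ^ 4) + \<zeta> * psi z"
proof -
  have "norm \<zeta> = 1" using assms(2) by (rule norm_root_of_unity) simp
  then have "norm (\<zeta> * z) < 1" using assms(1) by (simp add: norm_mult)
  then have "phi (\<zeta> * z) = phi ((\<zeta> * z) ^ 4) + psi (\<zeta> * z)" by (rule phi_split)
  moreover have "psi (\<zeta> * z) = \<zeta> ^ 1 * psi z"
    using assms by (intro eval_fps_rotate supported_theta_odd conv_radius_theta) auto
  ultimately show ?thesis by (simp add: power_mult_distrib)
qed

section \<open>The product identity for phi(z) phi(-z)\<close>

lemma qlists_2_eq: "qlists P c 2 m = (\<lambda>(x, y). [x, y]) `
    {(x, y). P x \<and> P y \<and> int c * x\<^sup>2 + int c * y\<^sup>2 = int m}"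
proof -
  have "xs \<in> (\<lambda>(x, y). [x, y]) ` {(x, y). P x \<and> P y \<and> int c * x\<^sup>2 + int c * y\<^sup>2 = int m}"
    if "xs \<in> qlists P c 2 m" for xs
  proof -
    from that have "length xs = Suc (Suc 0)" by (simp add: qlists_def)
    then obtain x y where "xs = [x, y]" by (auto simp: length_Suc_conv)
    then show ?thesis using that by (auto simp: qlists_def)
  qed
  then show ?thesis by (auto simp: qlists_def)
qed

text \<open>Up to conjugation the bijection is multiplication by the Gaussian integer
  \<open>1 + i\<close>, of norm 2. It is onto because the entries of a pair with even norm have the
  same parity.\<close>

lemma theta_all_square_double: "(theta_all 1 ^ 2) $ (2 * m) = (theta_all 1 ^ 2) $ m"
proof -
  let ?S = "\<lambda>m. {(x, y). x\<^sup>2 + y\<^sup>2 = int m}"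
  have card: "card (qlists (\<lambda>_. True) 1 2 m) = card (?S m)" for m
    unfolding qlists_2_eq by (subst card_image) (auto simp: inj_on_def)
  have "bij_betw (\<lambda>(x, y). (x + y, x - y)) (?S m) (?S (2 * m))"
  proof (rule bij_betw_byWitness[where f' = "\<lambda>(x, y). ((x + y) div 2, (x - y) div 2)"])
    show "(\<lambda>(x, y). (x + y, x - y)) ` ?S m \<subseteq> ?S (2 * m)"
      by (auto simp: power2_eq_square algebra_simps)
    have *: "\<exists>u v. x = u + v \<and> y = u - v" if "x\<^sup>2 + y\<^sup>2 = 2 * int m" for x y :: int
    proof -
      have "even (x\<^sup>2 + y\<^sup>2)" using that by simp
      then have "even (x - y)" by simp
      then obtain v where "x - y = 2 * v" by (elim evenE)
      then show ?thesis by (intro exI[of _ "y + v"] exI[of _ v]) simp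
    qed
    show "\<forall>p\<in>?S (2 * m). (\<lambda>(x, y). (x + y, x - y)) ((\<lambda>(x, y). ((x + y) div 2, (x - y) div 2)) p) = p"
      using * by fastforce
    show "(\<lambda>(x, y). ((x + y) div 2, (x - y) div 2)) ` ?S (2 * m) \<subseteq> ?S m"
    proof clarsimp
      fix x y :: int assume "x\<^sup>2 + y\<^sup>2 = 2 * int m"
      moreover from *[OF this] obtain u v where uv: "x = u + v" "y = u - v" by blast
      ultimately have "u\<^sup>2 + v\<^sup>2 = int m" by (simp add: power2_eq_square algebra_simps)
      moreover have "(x + y) div 2 = u" "(x - y) div 2 = v" by (simp_all add: uv)
      ultimately show "((x + y) div 2)\<^sup>2 + ((x - y) div 2)\<^sup>2 = int m" by simp
    qed
  qed auto
  then show ?thesis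
    using card[of m] card[of "2 * m"] by (simp add: theta_power_nth bij_betw_same_card)
qed

text \<open>The left side is \<open>E^2 - O^2\<close>, and \<open>phi^2 = E^2 + O^2 + 2 E O\<close>.
  These three terms have exponents 0 modulo 4, 2 modulo 4 and 1 modulo 4. Hence the coefficient of
  \<open>E^2 - O^2\<close> at \<open>2 * k\<close> is that of \<open>phi^2\<close> up to the sign
  \<open>(-1)^k\<close>, and doubling the index does not change the coefficients of
  \<open>phi^2\<close>.\<close>

lemma phi_mult_phi_minus:
  assumes "norm z < 1"
  shows "phi z * phi (- z) = (phi (- (z\<^sup>2)))\<^sup>2"
proof -
  let ?A = "theta_all 1" and ?E = "theta even 1" and ?O = "theta odd 1"
  note conv = norm_less_conv_radius[OF assms conv_radius_theta]
  have z2: "norm (- (z\<^sup>2)) < 1" using assms by (simp add: norm_power power_less_one_iff)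
  have A2: "?A ^ 2 = ?E ^ 2 + ?O ^ 2 + 2 * (?E * ?O)"
    by (simp add: theta_all_split power2_eq_square algebra_simps)
  have supE: "supported 4 0 (?E ^ 2)" using supported_power[OF supported_theta_even, of 2] by simp
  have supO: "supported 4 2 (?O ^ 2)"
    using supported_weaken[OF supported_power[OF supported_theta_odd[of 1], of 2], of 4] by simp
  have supEO: "supported 4 1 (?E * ?O)"
    using supported_mult[OF supported_theta_even supported_weaken[OF supported_theta_odd, of 4]]
    by fastforce
  have coeff: "(?E ^ 2 - ?O ^ 2) $ (2 * k) = (- 1) ^ k * (?A ^ 2) $ k" for k
  proof -
    have "\<not> [2 * k = 1] (mod 4)" unfolding cong_def by presburger
    then have EO: "(?E * ?O) $ (2 * k) = 0" using supEO by (auto simp: supported_def)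
    have "(?A ^ 2) $ k = (?A ^ 2) $ (2 * k)" by (rule theta_all_square_double[symmetric])
    also have "\<dots> = (?E ^ 2) $ (2 * k) + (?O ^ 2) $ (2 * k) + 2 * (?E * ?O) $ (2 * k)"
      unfolding A2 by (simp add: numeral_fps_const)
    finally have A: "(?A ^ 2) $ k = (?E ^ 2) $ (2 * k) + (?O ^ 2) $ (2 * k)" using EO by simp
    show ?thesis
    proof (cases "even k")
      case True
      then have "\<not> [2 * k = 2] (mod 4)" unfolding cong_def by presburger
      then have "(?O ^ 2) $ (2 * k) = 0" using supO unfolding supported_def by blast
      then show ?thesis using A True by simp
    next
      case False
      then have "\<not> [2 * k = 0] (mod 4)" unfolding cong_def by presburger
      then have "(?E ^ 2) $ (2 * k) = 0" using supE unfolding supported_def by blast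
      then show ?thesis using A False by simp
    qed
  qed
  have odd0: "(?E ^ 2 - ?O ^ 2) $ n = 0" if "odd n" for n
  proof -
    have "\<not> [n = 0] (mod 4)" "\<not> [n = 2] (mod 4)" using that unfolding cong_def by presburger+
    then have "(?E ^ 2) $ n = 0" "(?O ^ 2) $ n = 0"
      using supE supO unfolding supported_def by blast+
    then show ?thesis by simp
  qed
  have "phi (- z) = phi (z ^ 4) - psi z"
    using phi_rotate[OF assms, of "-1"] by simp
  with phi_split[OF assms] have "phi z * phi (- z) = (phi (z ^ 4) + psi z) * (phi (z ^ 4) - psi z)"
    by (simp only:)
  also have "\<dots> = (phi (z ^ 4))\<^sup>2 - (psi z)\<^sup>2" by (simp add: power2_eq_square algebra_simps)
  finally have "phi z * phi (- z) = (phi (z ^ 4))\<^sup>2 - (psi z)\<^sup>2" .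
  also have "\<dots> = eval_fps (?E ^ 2) z - eval_fps (?O ^ 2) z"
    by (simp add: eval_fps_power conv eval_theta_even flip: eval_theta_even)
  also have "\<dots> = eval_fps (?E ^ 2 - ?O ^ 2) z"
    by (rule eval_fps_diff[symmetric])
      (use assms in \<open>auto intro!: norm_less_conv_radius conv_radius_ge_intros\<close>)
  also have "\<dots> = (\<Sum>k. (?E ^ 2 - ?O ^ 2) $ (2 * k) * z ^ (2 * k))"
    unfolding eval_fps_def
    by (rule suminf_mono_reindex[symmetric]) (use odd0 in \<open>auto simp: strict_mono_def elim!: oddE evenE\<close>)
  also have "\<dots> = eval_fps (?A ^ 2) (- (z\<^sup>2))"
    unfolding coeff eval_fps_def
    by (intro suminf_cong) (simp add: power_mult power_minus[of "z\<^sup>2"])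
  also have "\<dots> = (phi (- (z\<^sup>2)))\<^sup>2"
    by (rule eval_fps_power) (use z2 in \<open>auto intro!: norm_less_conv_radius conv_radius_theta\<close>)
  finally show ?thesis .
qed

section \<open>Growth and decay of phi on the real axis\<close>

lemma phi_sums:
  assumes "norm z < 1"
  shows "(\<lambda>n. z ^ (n\<^sup>2)) sums ((phi z + 1) / 2)"
proof -
  have "(\<lambda>m. theta_all 1 $ m * z ^ m) sums phi z"
    using assms by (intro sums_eval_fps norm_less_conv_radius conv_radius_theta) auto
  also have "(\<lambda>m. theta_all 1 $ m * z ^ m) sums phi z \<longleftrightarrow>
      (\<lambda>n. theta_all 1 $ (n\<^sup>2) * z ^ (n\<^sup>2)) sums phi z"
  proof (rule sums_mono_reindex[symmetric])
    show "strict_mono (\<lambda>n::nat. n\<^sup>2)" by (auto simp: strict_mono_def intro!: power_strict_mono)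
    fix m assume m: "m \<notin> range (\<lambda>n::nat. n\<^sup>2)"
    have "theta_all 1 $ m = 0"
    proof (rule ccontr)
      assume "theta_all 1 $ m \<noteq> 0"
      then obtain x where "int 1 * x\<^sup>2 = int m" by (elim theta_nonzeroE)
      then have "int ((nat \<bar>x\<bar>)\<^sup>2) = int m" by simp
      then have "(nat \<bar>x\<bar>)\<^sup>2 = m" by (simp only: of_nat_eq_iff)
      then show False using m by auto
    qed
    then show "theta_all 1 $ m * z ^ m = 0" by simp
  qed
  \<comment> \<open>The square 0 has one root and every other square two; adding 1 at
    \<open>n = 0\<close> makes all coefficients equal to 2.\<close>
  finally have "(\<lambda>n. theta_all 1 $ (n\<^sup>2) * z ^ (n\<^sup>2) + (if n = 0 then 1 else 0)) sums (phi z + 1)"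
    by (intro sums_add) (auto intro: sums_single[of 0 "\<lambda>_. 1", simplified])
  moreover have "theta_all 1 $ (n\<^sup>2) * z ^ (n\<^sup>2) + (if n = 0 then 1 else 0) = 2 * z ^ (n\<^sup>2)" for n
  proof -
    have "{x. int 1 * x\<^sup>2 = int (n\<^sup>2)} = {int n, - int n}"
      by (auto simp: power2_eq_iff)
    then have "theta_all 1 $ (n\<^sup>2) = (if n = 0 then 1 else 2)"
      by (simp add: theta_nth)
    then show ?thesis by simp
  qed
  ultimately have "(\<lambda>n. 2 * z ^ (n\<^sup>2)) sums (phi z + 1)" by simp
  then have "(\<lambda>n. 2 * z ^ (n\<^sup>2) / 2) sums ((phi z + 1) / 2)" by (rule sums_divide)
  then show ?thesis by simp
qed

lemma phi_real_sums:
  assumes "\<bar>x\<bar> < 1"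
  shows "Im (phi (of_real x)) = 0" "(\<lambda>n. x ^ (n\<^sup>2)) sums ((Re (phi (of_real x)) + 1) / 2)"
proof -
  have s: "(\<lambda>n. of_real x ^ (n\<^sup>2)) sums ((phi (of_real x) + 1) / 2)"
    using assms by (intro phi_sums) simp
  from sums_Im[OF s] have "(\<lambda>n. 0) sums (Im (phi (of_real x)) / 2)"
    by (simp flip: of_real_power)
  then show "Im (phi (of_real x)) = 0" using sums_unique2[OF sums_zero] by fastforce
  from sums_Re[OF s] show "(\<lambda>n. x ^ (n\<^sup>2)) sums ((Re (phi (of_real x)) + 1) / 2)"
    by (simp flip: of_real_power)
qed

text \<open>As \<open>n^2\<close> and \<open>n\<close> have the same parity, the one-sided sum
  \<open>(phi (- q) + 1) / 2\<close> is alternating with decreasing terms and first term 1, so it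
  lies between 0 and 1.\<close>

lemma norm_phi_minus_le:
  assumes "0 < q" "q < 1"
  shows "norm (phi (- of_real q)) \<le> 1"
proof -
  have eq: "(- q) ^ (n\<^sup>2) = (- 1) ^ n * q ^ (n\<^sup>2)" for n
    by (simp add: power_minus[of q] power2_eq_square power_mult_distrib minus_one_power_iff)
  let ?a = "\<lambda>n::nat. q ^ (n\<^sup>2)"
  have "(\<lambda>n. q ^ n) \<longlonglongrightarrow> 0" using assms by (intro LIMSEQ_power_zero) auto
  then have "?a \<longlonglongrightarrow> 0"
    by (rule filterlim_compose) (auto intro!: filterlim_subseq simp: strict_mono_def power_strict_mono)
  moreover have "monoseq ?a"
    using assms by (intro decseq_imp_monoseq) (auto simp: decseq_def intro!: power_decreasing power_mono)
  ultimately have "0 < ?a 0 \<longrightarrow>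
      (\<forall>n. (\<Sum>i. (- 1) ^ i * ?a i) \<in> {\<Sum>i<2 * n. (- 1) ^ i * ?a i..\<Sum>i<2 * n + 1. (- 1) ^ i * ?a i})"
    by (rule summable_Leibniz(2))
  \<comment> \<open>The first two partial sums, the empty one and the single term 1, are the
    bounds.\<close>
  from this[rule_format, of 0] have "0 \<le> (\<Sum>i. (- 1) ^ i * ?a i)" "(\<Sum>i. (- 1) ^ i * ?a i) \<le> 1"
    by simp_all
  moreover have "(\<Sum>i. (- 1) ^ i * ?a i) = (Re (phi (of_real (- q))) + 1) / 2"
    using phi_real_sums(2)[of "- q"] assms by (simp add: eq sums_iff)
  ultimately have "0 \<le> (Re (phi (of_real (- q))) + 1) / 2" "(Re (phi (of_real (- q))) + 1) / 2 \<le> 1"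
    by (simp_all only:)
  then have "\<bar>Re (phi (of_real (- q)))\<bar> \<le> 1" by (simp add: abs_le_iff)
  then show ?thesis
    using phi_real_sums(1)[of "- q"] assms by (simp add: cmod_def)
qed

text \<open>The first \<open>N\<close> terms of the one-sided sum after the constant one are at
  least 1/2 each, for \<open>N\<close> about \<open>1 / sqrt (2 * (1 - q))\<close>; so
  \<open>phi q\<close> is at least \<open>N + 1\<close>.\<close>

lemma norm_phi_ge:
  assumes "0 < q" "q < 1"
  shows "norm (phi (of_real q)) \<ge> 1 / sqrt (2 * (1 - q))"
proof -
  \<comment> \<open>Chosen so that \<open>N^2 * (1 - q)\<close> is at most 1/2 for the integer part
    \<open>N\<close> of \<open>s\<close>; Bernoulli's inequality then gives
    \<open>q ^ (N^2) \<ge> 1/2\<close>.\<close>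
  define s where "s = 1 / sqrt (2 * (1 - q))"
  define N where "N = nat \<lfloor>s\<rfloor>"
  have s: "s > 0" "s\<^sup>2 * (2 * (1 - q)) = 1"
    using assms by (simp_all add: s_def power_divide)
  have N: "real N \<le> s" "s < real N + 1"
    using s(1) by (simp_all add: N_def)
  have "(real N)\<^sup>2 \<le> s\<^sup>2" using N s by (intro power_mono) auto
  then have "(real N)\<^sup>2 * (2 * (1 - q)) \<le> 1"
    using s(2) assms by (metis diff_ge_0_iff_ge less_imp_le mult_nonneg_nonneg mult_right_mono zero_le_numeral)
  then have "1 / 2 \<le> 1 + real (N\<^sup>2) * (q - 1)" by (simp add: algebra_simps)
  also have "\<dots> \<le> (1 + (q - 1)) ^ (N\<^sup>2)" using assms by (intro Bernoulli_inequality) simp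
  finally have half: "1 / 2 \<le> q ^ (N\<^sup>2)" by simp
  note sums = phi_real_sums(2)[of q]
  have "1 + real N / 2 = 1 + (\<Sum>n\<in>{1..N}. 1 / 2)" by simp
  also have "\<dots> \<le> 1 + (\<Sum>n\<in>{1..N}. q ^ (n\<^sup>2))"
  proof (intro add_left_mono sum_mono)
    fix n assume "n \<in> {1..N}"
    then have "q ^ (N\<^sup>2) \<le> q ^ (n\<^sup>2)"
      using assms by (intro power_decreasing) (auto intro!: power_mono)
    then show "1 / 2 \<le> q ^ (n\<^sup>2)" using half by simp
  qed
  also have "\<dots> = (\<Sum>n\<in>insert 0 {1..N}. q ^ (n\<^sup>2))" by (subst sum.insert) auto
  also have "\<dots> \<le> (\<Sum>n. q ^ (n\<^sup>2))"
    using sums assms by (intro sum_le_suminf) (auto simp: sums_iff)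
  also have "\<dots> = (Re (phi (of_real q)) + 1) / 2"
    using sums assms by (simp add: sums_iff)
  finally have "real N + 1 \<le> Re (phi (of_real q))" by simp
  then show ?thesis
    using N(2) complex_Re_le_cmod[of "phi (of_real q)"] unfolding s_def by linarith
qed

text \<open>Induction through \<open>phi (- q) = phi (- q^2)^2 / phi q\<close>: squaring doubles the
  order of decay, and the lower bound for \<open>phi q\<close> gains one more factor
  \<open>sqrt (1 - q)\<close>. The gain is what starts the induction from mere boundedness.\<close>

lemma phi_minus_decay_sqrt:
  "\<exists>A\<ge>0. \<forall>q. 0 < q \<and> q < 1 \<longrightarrow> norm (phi (- of_real q)) \<le> A * sqrt (1 - q) ^ k"
proof (induction k)
  case 0
  then show ?case using norm_phi_minus_le by (intro exI[of _ 1]) auto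
next
  case (Suc k)
  then obtain A where A: "A \<ge> 0"
    "\<And>q. 0 < q \<Longrightarrow> q < 1 \<Longrightarrow> norm (phi (- of_real q)) \<le> A * sqrt (1 - q) ^ k"
    by blast
  \<comment> \<open>The first \<open>sqrt 2\<close> comes from the lower bound for
    \<open>phi q\<close>, and \<open>sqrt 2 ^ k\<close> from replacing \<open>1 - q^2\<close> by
    \<open>2 * (1 - q)\<close>.\<close>
  have "norm (phi (- of_real q)) \<le> sqrt 2 * (A * sqrt 2 ^ k)\<^sup>2 * sqrt (1 - q) ^ Suc k"
    if q: "0 < q" "q < 1" for q
  proof -
    let ?t = "sqrt (1 - q)"
    have t: "0 < ?t" "?t \<le> 1" using q by auto
    have q2: "0 < q\<^sup>2" "q\<^sup>2 < 1" using q by (auto simp: power_less_one_iff)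
    have "norm (phi (- of_real (q\<^sup>2))) \<le> A * sqrt (1 - q\<^sup>2) ^ k"
      using A(2)[OF q2] by simp
    also have "sqrt (1 - q\<^sup>2) \<le> sqrt (2 * (1 - q))"
    proof (rule real_sqrt_le_mono)
      have "0 \<le> (1 - q)\<^sup>2" by simp
      then show "1 - q\<^sup>2 \<le> 2 * (1 - q)" by (simp add: power2_eq_square algebra_simps)
    qed
    then have "A * sqrt (1 - q\<^sup>2) ^ k \<le> A * sqrt (2 * (1 - q)) ^ k"
      using A(1) q2 by (intro mult_left_mono power_mono) auto
    also have "\<dots> = A * sqrt 2 ^ k * ?t ^ k" unfolding real_sqrt_mult power_mult_distrib by simp
    finally have *: "norm (phi (- of_real (q\<^sup>2))) \<le> A * sqrt 2 ^ k * ?t ^ k" .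
    have "norm (phi (of_real q)) * norm (phi (- of_real q)) = (norm (phi (- of_real (q\<^sup>2))))\<^sup>2"
      using phi_mult_phi_minus[of "of_real q"] q by (simp add: norm_power flip: norm_mult)
    also have "\<dots> \<le> (A * sqrt 2 ^ k * ?t ^ k)\<^sup>2"
      using * by (intro power_mono) auto
    finally have "norm (phi (of_real q)) * norm (phi (- of_real q)) \<le> (A * sqrt 2 ^ k)\<^sup>2 * ?t ^ k * ?t ^ k"
      by (simp add: power2_eq_square ac_simps)
    moreover have "1 / (sqrt 2 * ?t) * norm (phi (- of_real q)) \<le>
        norm (phi (of_real q)) * norm (phi (- of_real q))"
      using norm_phi_ge[OF q] unfolding real_sqrt_mult by (rule mult_right_mono) simp
    ultimately have "1 / (sqrt 2 * ?t) * norm (phi (- of_real q)) \<le> (A * sqrt 2 ^ k)\<^sup>2 * ?t ^ k * ?t ^ k"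
      by linarith
    then have "norm (phi (- of_real q)) \<le> (sqrt 2 * ?t) * ((A * sqrt 2 ^ k)\<^sup>2 * ?t ^ k * ?t ^ k)"
      using t by (simp add: field_simps)
    also have "\<dots> = sqrt 2 * (A * sqrt 2 ^ k)\<^sup>2 * ?t ^ Suc k * ?t ^ k" by (simp add: ac_simps)
    \<comment> \<open>The order reached is \<open>2 * k + 1\<close>; the surplus factor is at most 1
      and is dropped.\<close>
    also have "\<dots> \<le> sqrt 2 * (A * sqrt 2 ^ k)\<^sup>2 * ?t ^ Suc k * 1"
      using t by (intro mult_left_mono power_le_one) auto
    finally show ?thesis by simp
  qed
  then show ?case by (intro exI[of _ "sqrt 2 * (A * sqrt 2 ^ k)\<^sup>2"]) auto
qed

section \<open>Radial behaviour at roots of unity\<close>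

text \<open>Decay at 1 faster than any power of \<open>1 - q\<close>. The bounds range over the
  whole interval rather than a neighbourhood of 1, which keeps filters out of the calculus
  below.\<close>

definition flat :: "(real \<Rightarrow> complex) \<Rightarrow> bool" where
  "flat f \<longleftrightarrow> (\<forall>k. \<exists>A. \<forall>q. 0 < q \<and> q < 1 \<longrightarrow> norm (f q) \<le> A * (1 - q) ^ k)"

text \<open>At most polynomial growth in \<open>1 / (1 - q)\<close>, which a flat factor always
  outweighs.\<close>

definition tame :: "(real \<Rightarrow> complex) \<Rightarrow> bool" where
  "tame f \<longleftrightarrow> (\<exists>k A. \<forall>q. 0 < q \<and> q < 1 \<longrightarrow> norm (f q) * (1 - q) ^ k \<le> A)"

lemma flatI:
  assumes "\<And>k. \<exists>A. \<forall>q. 0 < q \<and> q < 1 \<longrightarrow> norm (f q) \<le> A * (1 - q) ^ k"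
  shows "flat f"
  using assms by (simp add: flat_def)

lemma flatE:
  assumes "flat f"
  obtains A where "A \<ge> 0" "\<And>q. 0 < q \<Longrightarrow> q < 1 \<Longrightarrow> norm (f q) \<le> A * (1 - q) ^ k"
proof -
  from assms obtain A where A: "\<And>q. 0 < q \<Longrightarrow> q < 1 \<Longrightarrow> norm (f q) \<le> A * (1 - q) ^ k"
    unfolding flat_def by blast
  have "0 \<le> A * (1 - 1/2) ^ k" using A[of "1/2"] norm_ge_zero[of "f (1/2)"] by linarith
  moreover have "(1 - 1/2 :: real) ^ k > 0" by simp
  ultimately have "A \<ge> 0" by (metis mult_neg_pos not_le)
  with A that show thesis by blast
qed

lemma flat_imp_tame: "flat f \<Longrightarrow> tame f"
  unfolding flat_def tame_def by (metis mult.right_neutral power_0)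

lemma flat_add:
  assumes "flat f" "flat g"
  shows "flat (\<lambda>q. f q + g q)"
proof (rule flatI)
  fix k
  obtain A where A: "\<And>q. 0 < q \<Longrightarrow> q < 1 \<Longrightarrow> norm (f q) \<le> A * (1 - q) ^ k"
    using assms(1) by (elim flatE) blast
  obtain B where B: "\<And>q. 0 < q \<Longrightarrow> q < 1 \<Longrightarrow> norm (g q) \<le> B * (1 - q) ^ k"
    using assms(2) by (elim flatE) blast
  have "norm (f q + g q) \<le> (A + B) * (1 - q) ^ k" if "0 < q" "q < 1" for q
    using norm_triangle_ineq[of "f q" "g q"] A[OF that] B[OF that] by (simp add: algebra_simps)
  then show "\<exists>C. \<forall>q. 0 < q \<and> q < 1 \<longrightarrow> norm (f q + g q) \<le> C * (1 - q) ^ k" by blast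
qed

lemma flat_mult_tame:
  assumes "flat f" "tame g"
  shows "flat (\<lambda>q. f q * g q)"
proof (rule flatI)
  fix k
  obtain l B where B: "\<And>q. 0 < q \<Longrightarrow> q < 1 \<Longrightarrow> norm (g q) * (1 - q) ^ l \<le> B"
    using assms(2) unfolding tame_def by blast
  \<comment> \<open>The extra \<open>l\<close> powers of decay absorb the growth of
    \<open>g\<close>.\<close>
  obtain A where A: "A \<ge> 0" "\<And>q. 0 < q \<Longrightarrow> q < 1 \<Longrightarrow> norm (f q) \<le> A * (1 - q) ^ (k + l)"
    by (rule flatE[OF assms(1), of "k + l"]) blast
  have "norm (f q * g q) \<le> A * B * (1 - q) ^ k" if q: "0 < q" "q < 1" for q
  proof -
    have "norm (f q * g q) \<le> A * (1 - q) ^ (k + l) * norm (g q)"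
      using A(2)[OF q] by (simp add: norm_mult mult_right_mono)
    also have "\<dots> = A * (1 - q) ^ k * (norm (g q) * (1 - q) ^ l)" by (simp add: power_add)
    also have "\<dots> \<le> A * (1 - q) ^ k * B" using B[OF q] A(1) q by (intro mult_left_mono) auto
    finally show ?thesis by (simp add: ac_simps)
  qed
  then show "\<exists>C. \<forall>q. 0 < q \<and> q < 1 \<longrightarrow> norm (f q * g q) \<le> C * (1 - q) ^ k" by blast
qed

lemma tame_const: "tame (\<lambda>_. c)"
  unfolding tame_def by (intro exI[of _ 0] exI[of _ "norm c"]) auto

lemma tame_mult:
  assumes "tame f" "tame g"
  shows "tame (\<lambda>q. f q * g q)"
proof -
  obtain k A where A: "\<And>q. 0 < q \<Longrightarrow> q < 1 \<Longrightarrow> norm (f q) * (1 - q) ^ k \<le> A"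
    using assms(1) unfolding tame_def by blast
  obtain l B where B: "\<And>q. 0 < q \<Longrightarrow> q < 1 \<Longrightarrow> norm (g q) * (1 - q) ^ l \<le> B"
    using assms(2) unfolding tame_def by blast
  have "norm (f q * g q) * (1 - q) ^ (k + l) \<le> A * B" if q: "0 < q" "q < 1" for q
  proof -
    have "norm (f q * g q) * (1 - q) ^ (k + l) =
        (norm (f q) * (1 - q) ^ k) * (norm (g q) * (1 - q) ^ l)"
      by (simp add: norm_mult power_add)
    also have "\<dots> \<le> A * B"
      using A[OF q] B[OF q] q order_trans[OF _ A[OF q]] by (intro mult_mono) auto
    finally show ?thesis .
  qed
  then show ?thesis unfolding tame_def by blast
qed

lemma tame_power: "tame f \<Longrightarrow> tame (\<lambda>q. f q ^ n)"
  by (induction n) (auto intro: tame_const tame_mult)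

text \<open>\<open>1 - q\<close> and \<open>1 - q ^ c\<close> are comparable, so flatness and
  tameness survive the substitution of \<open>q ^ c\<close> for \<open>q\<close>; this is needed for
  the series in \<open>q^3\<close> and \<open>q^4\<close>.\<close>

lemma one_minus_power_bounds:
  assumes "0 < q" "q < (1 :: real)" "c > 0"
  shows "1 - q ^ c \<le> real c * (1 - q)" "1 - q \<le> 1 - q ^ c" "0 < q ^ c" "q ^ c < 1"
proof -
  have "1 + real c * (q - 1) \<le> (1 + (q - 1)) ^ c"
    using assms by (intro Bernoulli_inequality) simp
  then show "1 - q ^ c \<le> real c * (1 - q)" by (simp add: algebra_simps)
  show "1 - q \<le> 1 - q ^ c" using power_decreasing[of 1 c q] assms by simp
  show "0 < q ^ c" "q ^ c < 1" using assms by (simp_all add: power_less_one_iff)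
qed

lemma flat_compose_power:
  assumes "flat f" "c > 0"
  shows "flat (\<lambda>q. f (q ^ c))"
proof (rule flatI)
  fix k
  obtain A where A: "A \<ge> 0" "\<And>q. 0 < q \<Longrightarrow> q < 1 \<Longrightarrow> norm (f q) \<le> A * (1 - q) ^ k"
    by (rule flatE[OF assms(1), of k]) blast
  have "norm (f (q ^ c)) \<le> A * real c ^ k * (1 - q) ^ k" if q: "0 < q" "q < 1" for q
  proof -
    note b = one_minus_power_bounds[OF q assms(2)]
    have "norm (f (q ^ c)) \<le> A * (1 - q ^ c) ^ k" using A(2) b by simp
    also have "\<dots> \<le> A * (real c * (1 - q)) ^ k"
      using A(1) b by (intro mult_left_mono power_mono) auto
    finally show ?thesis by (simp add: power_mult_distrib)
  qed
  then show "\<exists>C. \<forall>q. 0 < q \<and> q < 1 \<longrightarrow> norm (f (q ^ c)) \<le> C * (1 - q) ^ k" by blast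
qed

lemma tame_compose_power:
  assumes "tame f" "c > 0"
  shows "tame (\<lambda>q. f (q ^ c))"
proof -
  obtain k A where A: "\<And>q. 0 < q \<Longrightarrow> q < 1 \<Longrightarrow> norm (f q) * (1 - q) ^ k \<le> A"
    using assms(1) unfolding tame_def by blast
  have "norm (f (q ^ c)) * (1 - q) ^ k \<le> A" if q: "0 < q" "q < 1" for q
  proof -
    note b = one_minus_power_bounds[OF q assms(2)]
    have "norm (f (q ^ c)) * (1 - q) ^ k \<le> norm (f (q ^ c)) * (1 - q ^ c) ^ k"
      using b q by (intro mult_left_mono power_mono) auto
    also have "\<dots> \<le> A" using A b by simp
    finally show ?thesis .
  qed
  then show ?thesis unfolding tame_def by blast
qed

section \<open>Equality up to flat errors\<close>

text \<open>Tameness of the second function is built in because it keeps the error flat when such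
  relations are multiplied.\<close>

definition near :: "(real \<Rightarrow> complex) \<Rightarrow> (real \<Rightarrow> complex) \<Rightarrow> bool" where
  "near f g \<longleftrightarrow> flat (\<lambda>q. f q - g q) \<and> tame g"

lemma near_refl: "tame f \<Longrightarrow> near f f"
  by (auto simp: near_def flat_def intro!: exI[of _ 0])

lemma near_add:
  assumes "near f f'" "near g g'" "tame (\<lambda>q. f' q + g' q)"
  shows "near (\<lambda>q. f q + g q) (\<lambda>q. f' q + g' q)"
proof -
  have "flat (\<lambda>q. (f q - f' q) + (g q - g' q))"
    using assms(1,2) by (intro flat_add) (auto simp: near_def)
  then show ?thesis using assms(3) by (simp add: near_def algebra_simps)
qed

lemma near_mult:
  assumes "near f f'" "near g g'"
  shows "near (\<lambda>q. f q * g q) (\<lambda>q. f' q * g' q)"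
proof -
  have f: "flat (\<lambda>q. f q - f' q)" "tame f'" and g: "flat (\<lambda>q. g q - g' q)" "tame g'"
    using assms by (auto simp: near_def)
  \<comment> \<open>This sum is \<open>f g - f' g'\<close>, arranged so that every product has a
    flat factor and a tame one.\<close>
  have "flat (\<lambda>q. ((f q - f' q) * (g q - g' q) + (f q - f' q) * g' q) + (g q - g' q) * f' q)"
    by (intro flat_add flat_mult_tame f g flat_imp_tame)
  then show ?thesis
    using tame_mult[OF f(2) g(2)] by (simp add: near_def algebra_simps)
qed

lemma near_power: "near f g \<Longrightarrow> near (\<lambda>q. f q ^ n) (\<lambda>q. g q ^ n)"
  by (induction n) (auto intro: near_refl tame_const near_mult)

lemma near_cmult: "near f g \<Longrightarrow> near (\<lambda>q. c * f q) (\<lambda>q. c * g q)"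
  using near_mult[OF near_refl[OF tame_const]] by blast

lemma near_compose_power: "near f g \<Longrightarrow> c > 0 \<Longrightarrow> near (\<lambda>q. f (q ^ c)) (\<lambda>q. g (q ^ c))"
  using flat_compose_power[of "\<lambda>q. f q - g q"] tame_compose_power[of g] by (simp add: near_def)

lemma near_sum:
  assumes "\<And>i. i \<in> I \<Longrightarrow> near (f i) (\<lambda>q. \<kappa> i * g q)" "tame g"
  shows "near (\<lambda>q. \<Sum>i\<in>I. f i q) (\<lambda>q. (\<Sum>i\<in>I. \<kappa> i) * g q)"
  using assms(1)
proof (induction I rule: infinite_finite_induct)
  case (insert i I)
  have "near (\<lambda>q. f i q + (\<Sum>i\<in>I. f i q)) (\<lambda>q. \<kappa> i * g q + (\<Sum>i\<in>I. \<kappa> i) * g q)"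
  proof (rule near_add)
    have "tame (\<lambda>q. (\<kappa> i + (\<Sum>i\<in>I. \<kappa> i)) * g q)" by (intro tame_mult tame_const assms(2))
    then show "tame (\<lambda>q. \<kappa> i * g q + (\<Sum>i\<in>I. \<kappa> i) * g q)" by (simp add: distrib_right)
  qed (use insert in auto)
  then show ?case using insert(1,2) by (simp add: distrib_right)
qed (auto intro: near_refl tame_const)

lemma near_cong:
  assumes "near f g" "\<And>q. 0 < q \<Longrightarrow> q < 1 \<Longrightarrow> f q = f' q"
  shows "near f' g"
proof -
  have "flat (\<lambda>q. f' q - g q)"
  proof (rule flatI)
    fix k
    have "\<exists>A. \<forall>q. 0 < q \<and> q < 1 \<longrightarrow> norm (f q - g q) \<le> A * (1 - q) ^ k"
      using assms(1) by (simp add: near_def flat_def)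
    then show "\<exists>A. \<forall>q. 0 < q \<and> q < 1 \<longrightarrow> norm (f' q - g q) \<le> A * (1 - q) ^ k"
      using assms(2) by simp
  qed
  then show ?thesis using assms(1) by (simp add: near_def)
qed

section \<open>Theta functions along rays to eighth roots of unity\<close>

lemma flat_phi_minus: "flat (\<lambda>q. phi (- of_real q))"
proof (rule flatI)
  fix k
  obtain A where "\<And>q. 0 < q \<Longrightarrow> q < 1 \<Longrightarrow> norm (phi (- of_real q)) \<le> A * sqrt (1 - q) ^ (2 * k)"
    using phi_minus_decay_sqrt by blast
  then have "norm (phi (- of_real q)) \<le> A * (1 - q) ^ k" if "0 < q" "q < 1" for q
    using that by (force simp: power_mult)
  then show "\<exists>A. \<forall>q. 0 < q \<and> q < 1 \<longrightarrow> norm (phi (- of_real q)) \<le> A * (1 - q) ^ k" by blast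
qed

lemma tame_psi: "tame (\<lambda>q. psi (of_real q))"
proof -
  have "norm (psi (of_real q)) * (1 - q) ^ 1 \<le> 2" if q: "0 < q" "q < 1" for q
  proof -
    have geo: "(\<lambda>n. 2 * q ^ n) sums (2 * (1 / (1 - q)))"
      using q by (intro sums_mult geometric_sums) auto
    have "norm (psi (of_real q)) \<le> (\<Sum>n. 2 * q ^ n)"
      unfolding eval_fps_def
    proof (rule norm_suminf_le)
      show "summable (\<lambda>n. 2 * q ^ n)" using geo by (simp add: sums_iff)
      show "norm (theta odd 1 $ n * of_real q ^ n) \<le> 2 * q ^ n" for n
        using fps_nth_theta_le[of 1 odd n] q by (simp add: norm_mult norm_power mult_right_mono)
    qed
    also have "\<dots> = 2 / (1 - q)" using geo by (simp add: sums_iff)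
    finally show ?thesis using q by (simp add: field_simps)
  qed
  then show ?thesis unfolding tame_def by blast
qed

text \<open>\<open>\<zeta> ^ 4\<close> is 1 or -1. In the first case the even part is
  \<open>phi (q ^ 4) = phi (- q) + psi q\<close>, which is near \<open>psi q\<close>; in the second
  it is \<open>phi (- (q ^ 4))\<close>, which is flat. The odd part is \<zeta> times
  \<open>psi q\<close> exactly. The two conclusions serve the full and the even theta
  series.\<close>

lemma near_phi_rotate:
  assumes "\<zeta> ^ 8 = 1"
  obtains \<kappa> where "near (\<lambda>q. phi (\<zeta> * of_real q)) (\<lambda>q. \<kappa> * psi (of_real q))"
    "near (\<lambda>q. phi (\<zeta> ^ 4 * of_real (q ^ 4))) (\<lambda>q. (\<kappa> - \<zeta>) * psi (of_real q))"
proof -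
  have "(\<zeta> ^ 4)\<^sup>2 = 1" using assms by (simp flip: power_mult)
  then have \<zeta>4: "\<zeta> ^ 4 = 1 \<or> \<zeta> ^ 4 = - 1" unfolding power2_eq_1_iff .
  obtain \<epsilon> where \<epsilon>: "near (\<lambda>q. phi (\<zeta> ^ 4 * of_real (q ^ 4))) (\<lambda>q. \<epsilon> * psi (of_real q))"
  proof (cases "\<zeta> ^ 4 = 1")
    case True
    have "near (\<lambda>q. phi (- of_real q)) (\<lambda>q. 0)"
      using flat_phi_minus tame_const[of 0] by (simp add: near_def)
    then have "near (\<lambda>q. phi (- of_real q) + psi (of_real q)) (\<lambda>q. 0 + psi (of_real q))"
      using tame_psi by (intro near_add near_refl) simp_all
    then have "near (\<lambda>q. phi (\<zeta> ^ 4 * of_real (q ^ 4))) (\<lambda>q. 0 + psi (of_real q))"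
    proof (rule near_cong)
      fix q :: real assume "0 < q" "q < 1"
      then show "phi (- of_real q) + psi (of_real q) = phi (\<zeta> ^ 4 * of_real (q ^ 4))"
        using phi_rotate[of "of_real q" "-1"] True by simp
    qed
    then have "near (\<lambda>q. phi (\<zeta> ^ 4 * of_real (q ^ 4))) (\<lambda>q. 1 * psi (of_real q))" by simp
    then show thesis by (rule that)
  next
    case False
    then have "\<zeta> ^ 4 = - 1" using \<zeta>4 by blast
    then have "near (\<lambda>q. phi (\<zeta> ^ 4 * of_real (q ^ 4))) (\<lambda>q. 0 * psi (of_real q))"
      using flat_compose_power[OF flat_phi_minus, of 4] tame_const[of 0] by (simp add: near_def)
    then show thesis by (rule that)
  qed
  have "near (\<lambda>q. phi (\<zeta> ^ 4 * of_real (q ^ 4)) + \<zeta> * psi (of_real q))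
      (\<lambda>q. \<epsilon> * psi (of_real q) + \<zeta> * psi (of_real q))"
  proof (rule near_add[OF \<epsilon>])
    have "tame (\<lambda>q. (\<epsilon> + \<zeta>) * psi (of_real q))" by (intro tame_mult tame_const tame_psi)
    then show "tame (\<lambda>q. \<epsilon> * psi (of_real q) + \<zeta> * psi (of_real q))" by (simp add: distrib_right)
  qed (intro near_refl tame_mult tame_const tame_psi)
  then have n: "near (\<lambda>q. phi (\<zeta> ^ 4 * of_real (q ^ 4)) + \<zeta> * psi (of_real q))
      (\<lambda>q. (\<epsilon> + \<zeta>) * psi (of_real q))" by (simp add: distrib_right)
  then have "near (\<lambda>q. phi (\<zeta> * of_real q)) (\<lambda>q. (\<epsilon> + \<zeta>) * psi (of_real q))"
  proof (rule near_cong)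
    fix q :: real assume "0 < q" "q < 1"
    then show "phi (\<zeta> ^ 4 * of_real (q ^ 4)) + \<zeta> * psi (of_real q) = phi (\<zeta> * of_real q)"
      using phi_rotate[of "of_real q" \<zeta>] assms by simp
  qed
  then show thesis using \<epsilon> by (intro that[of "\<epsilon> + \<zeta>"]) simp_all
qed

text \<open>The all-odd product \<open>O^a O'^b\<close> on the real axis, the common yardstick for
  all products of theta series.\<close>

definition Psi :: "nat \<Rightarrow> nat \<Rightarrow> real \<Rightarrow> complex" where
  "Psi a b q = psi (of_real q) ^ a * psi (of_real (q ^ 3)) ^ b"

lemma tame_Psi: "tame (Psi a b)"
  unfolding Psi_def
  by (intro tame_mult tame_power tame_psi tame_compose_power[OF tame_psi]) simp

text \<open>All eight roots of unity are included because a residue class modulo 8 is extracted by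
  averaging over them; the constant may depend on the root.\<close>

definition proportional_near :: "nat \<Rightarrow> nat \<Rightarrow> complex fps \<Rightarrow> bool" where
  "proportional_near a b F \<longleftrightarrow> fps_conv_radius F \<ge> 1 \<and>
     (\<forall>\<zeta>. \<zeta> ^ 8 = 1 \<longrightarrow>
       (\<exists>\<kappa>. near (\<lambda>q. eval_fps F (\<zeta> * of_real q)) (\<lambda>q. \<kappa> * Psi a b q)))"

text \<open>The series in \<open>q^3\<close> at \<open>\<zeta> q\<close> is the series in
  \<open>q\<close> at \<open>\<zeta>^3 q^3\<close>, and \<open>\<zeta>^3\<close> is again an eighth
  root of unity, so the hypothesis on one theta series handles both factors.\<close>

lemma proportional_near_product:
  assumes "\<And>\<zeta>. \<zeta> ^ 8 = 1 \<Longrightarrow>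
    \<exists>\<kappa>. near (\<lambda>q. eval_fps (theta P 1) (\<zeta> * of_real q)) (\<lambda>q. \<kappa> * psi (of_real q))"
  shows "proportional_near a b (theta P 1 ^ a * theta P 3 ^ b)"
  unfolding proportional_near_def
proof (intro conjI allI impI)
  show "fps_conv_radius (theta P 1 ^ a * theta P 3 ^ b) \<ge> 1"
    by (intro conv_radius_ge_intros) auto
  fix \<zeta> :: complex assume \<zeta>: "\<zeta> ^ 8 = 1"
  then have "(\<zeta> ^ 3) ^ 8 = 1" by (metis power_mult mult.commute power_one)
  with assms obtain \<kappa>' where
    "near (\<lambda>q. eval_fps (theta P 1) (\<zeta> ^ 3 * of_real q)) (\<lambda>q. \<kappa>' * psi (of_real q))" by blast
  then have n3: "near (\<lambda>q. eval_fps (theta P 1) (\<zeta> ^ 3 * of_real (q ^ 3)))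
      (\<lambda>q. \<kappa>' * psi (of_real (q ^ 3)))"
    by (rule near_compose_power) simp
  obtain \<kappa> where
    n1: "near (\<lambda>q. eval_fps (theta P 1) (\<zeta> * of_real q)) (\<lambda>q. \<kappa> * psi (of_real q))"
    using assms[OF \<zeta>] by blast
  have "near (\<lambda>q. eval_fps (theta P 1) (\<zeta> * of_real q) ^ a *
        eval_fps (theta P 1) (\<zeta> ^ 3 * of_real (q ^ 3)) ^ b)
      (\<lambda>q. (\<kappa> * psi (of_real q)) ^ a * (\<kappa>' * psi (of_real (q ^ 3))) ^ b)"
    by (intro near_mult near_power n1 n3)
  then have "near (\<lambda>q. eval_fps (theta P 1 ^ a * theta P 3 ^ b) (\<zeta> * of_real q))
      (\<lambda>q. (\<kappa> * psi (of_real q)) ^ a * (\<kappa>' * psi (of_real (q ^ 3))) ^ b)"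
  proof (rule near_cong)
    fix q :: real assume q: "0 < q" "q < 1"
    have "norm \<zeta> = 1" using \<zeta> by (rule norm_root_of_unity) simp
    then have "norm (\<zeta> * of_real q) < 1" using q by (simp add: norm_mult)
    then show "eval_fps (theta P 1) (\<zeta> * of_real q) ^ a *
        eval_fps (theta P 1) (\<zeta> ^ 3 * of_real (q ^ 3)) ^ b =
        eval_fps (theta P 1 ^ a * theta P 3 ^ b) (\<zeta> * of_real q)"
      by (simp add: eval_fps_mult eval_fps_power norm_less_conv_radius conv_radius_ge_intros
          eval_theta_3 power_mult_distrib del: One_nat_def)
  qed
  then show "\<exists>\<kappa>. near (\<lambda>q. eval_fps (theta P 1 ^ a * theta P 3 ^ b) (\<zeta> * of_real q))
      (\<lambda>q. \<kappa> * Psi a b q)"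
    by (intro exI[of _ "\<kappa> ^ a * \<kappa>' ^ b"]) (simp add: Psi_def power_mult_distrib ac_simps)
qed

lemma proportional_near_theta_all: "proportional_near a b (theta_all 1 ^ a * theta_all 3 ^ b)"
  by (rule proportional_near_product) (metis near_phi_rotate)

lemma proportional_near_theta_even: "proportional_near a b (theta even 1 ^ a * theta even 3 ^ b)"
proof (rule proportional_near_product)
  fix \<zeta> :: complex assume "\<zeta> ^ 8 = 1"
  then obtain \<kappa> where
    "near (\<lambda>q. phi (\<zeta> ^ 4 * of_real (q ^ 4))) (\<lambda>q. (\<kappa> - \<zeta>) * psi (of_real q))"
    by (rule near_phi_rotate)
  then show "\<exists>\<kappa>. near (\<lambda>q. eval_fps (theta even 1) (\<zeta> * of_real q)) (\<lambda>q. \<kappa> * psi (of_real q))"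
    by (auto simp: eval_theta_even power_mult_distrib)
qed

lemma proportional_near_theta_odd: "proportional_near a b (theta odd 1 ^ a * theta odd 3 ^ b)"
proof (rule proportional_near_product)
  fix \<zeta> :: complex assume \<zeta>: "\<zeta> ^ 8 = 1"
  have "near (\<lambda>q. \<zeta> * psi (of_real q)) (\<lambda>q. \<zeta> * psi (of_real q))"
    by (intro near_refl tame_mult tame_const tame_psi)
  then have "near (\<lambda>q. psi (\<zeta> * of_real q)) (\<lambda>q. \<zeta> * psi (of_real q))"
  proof (rule near_cong)
    fix q :: real assume "0 < q" "q < 1"
    then show "\<zeta> * psi (of_real q) = psi (\<zeta> * of_real q)"
      using eval_fps_rotate[OF supported_theta_odd \<zeta> conv_radius_theta, of 1 "of_real q"] by simp
  qed
  then show "\<exists>\<kappa>. near (\<lambda>q. psi (\<zeta> * of_real q)) (\<lambda>q. \<kappa> * psi (of_real q))" by blast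
qed

lemma proportional_near_diff:
  assumes "proportional_near a b F" "proportional_near a b G"
  shows "proportional_near a b (F - fps_const c * G)"
  unfolding proportional_near_def
proof (intro conjI allI impI)
  have F: "fps_conv_radius F \<ge> 1" and G: "fps_conv_radius (fps_const c * G) \<ge> 1"
    using assms by (auto simp: proportional_near_def intro!: conv_radius_mult_ge)
  then show "fps_conv_radius (F - fps_const c * G) \<ge> 1" by (rule conv_radius_diff_ge)
  fix \<zeta> :: complex assume \<zeta>: "\<zeta> ^ 8 = 1"
  obtain \<kappa> \<mu> where \<kappa>: "near (\<lambda>q. eval_fps F (\<zeta> * of_real q)) (\<lambda>q. \<kappa> * Psi a b q)"
    and \<mu>: "near (\<lambda>q. eval_fps G (\<zeta> * of_real q)) (\<lambda>q. \<mu> * Psi a b q)"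
    using assms \<zeta> unfolding proportional_near_def by blast
  have t: "tame (\<lambda>q. (\<kappa> - c * \<mu>) * Psi a b q)" by (intro tame_mult tame_const tame_Psi)
  have "near (\<lambda>q. eval_fps F (\<zeta> * of_real q) + (- c) * eval_fps G (\<zeta> * of_real q))
      (\<lambda>q. \<kappa> * Psi a b q + (- c) * (\<mu> * Psi a b q))"
    using t by (intro near_add \<kappa> near_cmult \<mu>) (simp add: algebra_simps)
  then have "near (\<lambda>q. eval_fps (F - fps_const c * G) (\<zeta> * of_real q))
      (\<lambda>q. \<kappa> * Psi a b q + (- c) * (\<mu> * Psi a b q))"
  proof (rule near_cong)
    fix q :: real assume q: "0 < q" "q < 1"
    have "norm \<zeta> = 1" using \<zeta> by (rule norm_root_of_unity) simp
    then have z: "norm (\<zeta> * of_real q) < 1" using q by (simp add: norm_mult)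
    have "fps_conv_radius G \<ge> 1" using assms(2) by (simp add: proportional_near_def)
    then show "eval_fps F (\<zeta> * of_real q) + (- c) * eval_fps G (\<zeta> * of_real q) =
        eval_fps (F - fps_const c * G) (\<zeta> * of_real q)"
      unfolding eval_fps_diff[OF norm_less_conv_radius[OF z F] norm_less_conv_radius[OF z G]]
      by (subst eval_fps_mult[OF _ norm_less_conv_radius[OF z]]) simp_all
  qed
  then have "near (\<lambda>q. eval_fps (F - fps_const c * G) (\<zeta> * of_real q))
      (\<lambda>q. (\<kappa> - c * \<mu>) * Psi a b q)" by (simp add: algebra_simps)
  then show "\<exists>\<kappa>. near (\<lambda>q. eval_fps (F - fps_const c * G) (\<zeta> * of_real q)) (\<lambda>q. \<kappa> * Psi a b q)"
    by blast
qed

text \<open>\<open>2 psi q = phi q - phi (- q)\<close>, where the first term grows at least like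
  \<open>1 / sqrt (2 * (1 - q))\<close> and the second is bounded by 1.\<close>

lemma norm_psi_at_top: "filterlim (\<lambda>q. norm (psi (of_real q))) at_top (at_left 1)"
proof (rule filterlim_at_top_mono)
  show "filterlim (\<lambda>q::real. (1 / sqrt (2 * (1 - q)) - 1) / 2) at_top (at_left 1)"
    by real_asymp
  have "eventually (\<lambda>q::real. 0 < q \<and> q < 1) (at_left 1)"
    using eventually_at_left_real[of 0 1] by simp
  then show "\<forall>\<^sub>F q in at_left 1. (1 / sqrt (2 * (1 - q)) - 1) / 2 \<le> norm (psi (of_real q))"
  proof eventually_elim
    case (elim q)
    have "phi (of_real q) = phi (- of_real q) + 2 * psi (of_real q)"
      using phi_split[of "of_real q"] phi_rotate[of "of_real q" "-1"] elim by simp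
    then have "norm (phi (of_real q)) \<le> norm (phi (- of_real q)) + norm (2 * psi (of_real q))"
      using norm_triangle_ineq by metis
    also have "\<dots> \<le> 1 + 2 * norm (psi (of_real q))"
      using norm_phi_minus_le elim by (simp add: norm_mult)
    finally show ?case using norm_phi_ge elim by fastforce
  qed
qed

lemma norm_Psi_at_top:
  assumes "(a, b) \<noteq> (0, 0)"
  shows "filterlim (\<lambda>q. norm (Psi a b q)) at_top (at_left 1)"
proof -
  have "filterlim (\<lambda>q::real. q ^ 3) (at_left 1) (at_left 1)" by real_asymp
  from filterlim_compose[OF norm_psi_at_top this]
  have l3: "filterlim (\<lambda>q. norm (psi (of_real (q ^ 3)))) at_top (at_left 1)" .
  have Psi: "norm (Psi a b q) = norm (psi (of_real q)) ^ a * norm (psi (of_real (q ^ 3))) ^ b" for q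
    by (simp add: Psi_def norm_mult norm_power)
  show ?thesis
  proof (cases "a = 0 \<or> b = 0")
    case True
    then show ?thesis unfolding Psi
      using assms norm_psi_at_top l3 by (auto intro!: filterlim_pow_at_top)
  next
    case False
    then show ?thesis unfolding Psi
      using norm_psi_at_top l3 by (intro filterlim_at_top_mult_at_top filterlim_pow_at_top) auto
  qed
qed

section \<open>Extraction of a residue class modulo 8\<close>

lemma cis_pi_4_power:
  "cis (pi / 4) ^ n = exp (2 * of_real pi * \<i> * of_nat n / of_nat 8)"
proof -
  have "cis (pi / 4) ^ n = exp (of_nat n * (\<i> * of_real (pi / 4)))"
    unfolding cis_conv_exp by (rule exp_of_nat_mult[symmetric])
  also have "of_nat n * (\<i> * of_real (pi / 4)) = 2 * of_real pi * \<i> * of_nat n / of_nat 8"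
    by simp
  finally show ?thesis .
qed

lemma cis_pi_4_power_eq_1: "cis (pi / 4) ^ n = 1 \<longleftrightarrow> 8 dvd n"
  unfolding cis_pi_4_power by (rule complex_root_unity_eq_1) simp

text \<open>A discrete Fourier filter over the eighth roots of unity. The weight
  \<open>7 * r\<close> stands for \<open>- r\<close> modulo 8 in natural exponents. The vanishing
  hypothesis truncates the extracted section to a polynomial.\<close>

lemma section_mod_8:
  fixes F :: "complex fps" and q :: real
  assumes "fps_conv_radius F \<ge> 1" "0 < q" "q < 1"
    and zero: "\<And>m. [m = r] (mod 8) \<Longrightarrow> m \<ge> r \<Longrightarrow> F $ m = 0"
  shows "(\<Sum>k<8. cis (pi / 4) ^ (7 * r * k) * eval_fps F (cis (pi / 4) ^ k * of_real q)) =
    8 * (\<Sum>m | m < r \<and> [m = r] (mod 8). F $ m * of_real q ^ m)"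
proof -
  let ?\<omega> = "cis (pi / 4)"
  have filter: "(\<Sum>k<8. ?\<omega> ^ (7 * r * k) * ?\<omega> ^ (k * m)) = (if [m = r] (mod 8) then 8 else 0)" for m
  proof -
    have "(\<Sum>k<8. ?\<omega> ^ (7 * r * k) * ?\<omega> ^ (k * m)) = (\<Sum>k<8. (?\<omega> ^ (7 * r + m)) ^ k)"
      by (simp add: algebra_simps flip: power_add power_mult)
    moreover have "?\<omega> ^ (7 * r + m) = 1 \<longleftrightarrow> 8 dvd 7 * r + m" by (rule cis_pi_4_power_eq_1)
    moreover have "8 dvd 7 * r + m \<longleftrightarrow> [m = r] (mod 8)"
    proof -
      have "[7 * r + r = 0] (mod 8)" by (simp add: cong_0_iff)
      then have "8 dvd 7 * r + m \<longleftrightarrow> [7 * r + m = 7 * r + r] (mod 8)"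
        unfolding cong_0_iff[symmetric] by (metis cong_sym cong_trans)
      then show ?thesis by (simp only: cong_add_lcancel_nat)
    qed
    moreover have "(?\<omega> ^ (7 * r + m)) ^ 8 = 1"
      by (simp add: cis_pi_4_power_eq_1 flip: power_mult)
    ultimately show ?thesis by (auto simp: geometric_sum)
  qed
  have "(\<lambda>m. ?\<omega> ^ (7 * r * k) * (F $ m * (?\<omega> ^ k * of_real q) ^ m)) sums
      (?\<omega> ^ (7 * r * k) * eval_fps F (?\<omega> ^ k * of_real q))" for k
    using assms by (intro sums_mult sums_eval_fps norm_less_conv_radius)
      (auto simp: norm_mult norm_power)
  then have "(\<lambda>m. \<Sum>k<8. ?\<omega> ^ (7 * r * k) * (F $ m * (?\<omega> ^ k * of_real q) ^ m)) sums
      (\<Sum>k<8. ?\<omega> ^ (7 * r * k) * eval_fps F (?\<omega> ^ k * of_real q))"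
    by (intro sums_sum)
  moreover have "(\<Sum>k<8. ?\<omega> ^ (7 * r * k) * (F $ m * (?\<omega> ^ k * of_real q) ^ m)) =
      (if m \<in> {m. m < r \<and> [m = r] (mod 8)} then 8 * (F $ m * of_real q ^ m) else 0)" for m
  proof -
    have "(\<Sum>k<8. ?\<omega> ^ (7 * r * k) * (F $ m * (?\<omega> ^ k * of_real q) ^ m)) =
        (\<Sum>k<8. ?\<omega> ^ (7 * r * k) * ?\<omega> ^ (k * m)) * (F $ m * of_real q ^ m)"
      unfolding sum_distrib_right by (intro sum.cong) (simp_all add: power_mult_distrib power_mult)
    then show ?thesis unfolding filter using zero[of m] by auto
  qed
  ultimately have "(\<lambda>m. if m \<in> {m. m < r \<and> [m = r] (mod 8)} then 8 * (F $ m * of_real q ^ m) else 0)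
      sums (\<Sum>k<8. ?\<omega> ^ (7 * r * k) * eval_fps F (?\<omega> ^ k * of_real q))" by simp
  moreover have "(\<lambda>m. if m \<in> {m. m < r \<and> [m = r] (mod 8)} then 8 * (F $ m * of_real q ^ m) else 0)
      sums (\<Sum>m | m < r \<and> [m = r] (mod 8). 8 * (F $ m * of_real q ^ m))"
    by (rule sums_If_finite_set) simp
  ultimately have "(\<Sum>k<8. ?\<omega> ^ (7 * r * k) * eval_fps F (?\<omega> ^ k * of_real q)) =
      (\<Sum>m | m < r \<and> [m = r] (mod 8). 8 * (F $ m * of_real q ^ m))"
    by (rule sums_unique2)
  then show ?thesis by (simp only: sum_distrib_left)
qed

text \<open>The residue class section of \<open>F\<close> is a polynomial, hence bounded, while \<open>Psi\<close> blows up at 1.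
  So the constant of proportionality is 0 and the section is flat, hence vanishes at 1; as its
  coefficients all have the same sign, they vanish too.\<close>

lemma low_coeff_eq_0:
  fixes c :: "nat \<Rightarrow> real" and C :: complex
  assumes "(a, b) \<noteq> (0, 0)" "proportional_near a b F"
    and zero: "\<And>m. [m = r] (mod 8) \<Longrightarrow> m \<ge> r \<Longrightarrow> F $ m = 0"
    and low: "\<And>m. [m = r] (mod 8) \<Longrightarrow> m < r \<Longrightarrow> F $ m = C * of_real (c m)"
    and "\<And>m. c m \<ge> 0" "C \<noteq> 0"
    and m: "[m = r] (mod 8)" "m < r"
  shows "c m = 0"
proof -
  let ?\<omega> = "cis (pi / 4)" and ?M = "{m. m < r \<and> [m = r] (mod 8)}"
  define p where "p q = 8 * (\<Sum>m\<in>?M. F $ m * of_real q ^ m)" for q :: real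
  have "(?\<omega> ^ k) ^ 8 = 1" for k
    by (simp add: cis_pi_4_power_eq_1 flip: power_mult)
  then have "\<forall>k. \<exists>\<kappa>. near (\<lambda>q. eval_fps F (?\<omega> ^ k * of_real q)) (\<lambda>q. \<kappa> * Psi a b q)"
    using assms(2) unfolding proportional_near_def by blast
  then obtain \<kappa> where "\<And>k. near (\<lambda>q. eval_fps F (?\<omega> ^ k * of_real q)) (\<lambda>q. \<kappa> k * Psi a b q)"
    by metis
  then have "near (\<lambda>q. ?\<omega> ^ (7 * r * k) * eval_fps F (?\<omega> ^ k * of_real q))
      (\<lambda>q. (?\<omega> ^ (7 * r * k) * \<kappa> k) * Psi a b q)" for k
    using near_cmult by (simp add: mult.assoc)
  then have "near (\<lambda>q. \<Sum>k<8. ?\<omega> ^ (7 * r * k) * eval_fps F (?\<omega> ^ k * of_real q))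
      (\<lambda>q. (\<Sum>k<8. ?\<omega> ^ (7 * r * k) * \<kappa> k) * Psi a b q)"
    by (intro near_sum tame_Psi)
  then obtain K where "near (\<lambda>q. \<Sum>k<8. ?\<omega> ^ (7 * r * k) * eval_fps F (?\<omega> ^ k * of_real q))
      (\<lambda>q. K * Psi a b q)" by blast
  then have nearp: "near p (\<lambda>q. K * Psi a b q)"
  proof (rule near_cong)
    fix q :: real assume "0 < q" "q < 1"
    then show "(\<Sum>k<8. ?\<omega> ^ (7 * r * k) * eval_fps F (?\<omega> ^ k * of_real q)) = p q"
      unfolding p_def using assms(2) zero
      by (intro section_mod_8) (auto simp: proportional_near_def)
  qed
  have lim: "(p \<longlongrightarrow> p 1) (at_left 1)"
    unfolding p_def by (intro tendsto_intros)
  have ev: "eventually (\<lambda>q::real. 0 < q \<and> q < 1) (at_left 1)"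
    using eventually_at_left_real[of 0 1] by simp
  have flat_p: "flat (\<lambda>q. p q - K * Psi a b q)" using nearp by (simp add: near_def)
  \<comment> \<open>Decay of order 1 suffices here, since the error only has to tend to 0.\<close>
  obtain A where A: "\<And>q. 0 < q \<Longrightarrow> q < 1 \<Longrightarrow> norm (p q - K * Psi a b q) \<le> A * (1 - q) ^ 1"
    by (rule flatE[OF flat_p, of 1]) blast
  have "((\<lambda>q. p q - K * Psi a b q) \<longlongrightarrow> 0) (at_left 1)"
  proof (rule Lim_null_comparison)
    show "\<forall>\<^sub>F q in at_left 1. norm (p q - K * Psi a b q) \<le> A * (1 - q) ^ 1"
      using ev by eventually_elim (use A in blast)
    have "((\<lambda>q::real. A * (1 - q) ^ 1) \<longlongrightarrow> A * (1 - 1) ^ 1) (at_left 1)"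
      by (intro tendsto_intros)
    then show "((\<lambda>q::real. A * (1 - q) ^ 1) \<longlongrightarrow> 0) (at_left 1)" by simp
  qed
  from tendsto_diff[OF lim this] have limK: "((\<lambda>q. K * Psi a b q) \<longlongrightarrow> p 1) (at_left 1)" by simp
  have "K = 0"
  proof (rule ccontr)
    assume "K \<noteq> 0"
    then have top: "filterlim (\<lambda>q. norm K * norm (Psi a b q)) at_top (at_left 1)"
      using norm_Psi_at_top[OF assms(1)]
      by (intro filterlim_tendsto_pos_mult_at_top[OF tendsto_const]) auto
    have "((\<lambda>q. norm K * norm (Psi a b q)) \<longlongrightarrow> norm (p 1)) (at_left 1)"
      using tendsto_norm[OF limK] by (simp add: norm_mult)
    from not_tendsto_and_filterlim_at_infinity[OF trivial_limit_at_left_real this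
        filterlim_at_top_imp_at_infinity[OF top]]
    show False .
  qed
  then have "((\<lambda>q. 0) \<longlongrightarrow> p 1) (at_left (1 :: real))" using limK by simp
  then have "p 1 = 0" using tendsto_unique[OF trivial_limit_at_left_real tendsto_const] by metis
  moreover have "p 1 = 8 * (C * of_real (\<Sum>m\<in>?M. c m))"
    unfolding p_def by (simp add: low sum_distrib_left)
  ultimately have "(\<Sum>m\<in>?M. c m) = 0" using \<open>C \<noteq> 0\<close> by (simp flip: of_real_sum)
  then have "\<forall>m\<in>?M. c m = 0" using assms(5) by (subst (asm) sum_nonneg_eq_0_iff) auto
  then show ?thesis using m by blast
qed

section \<open>Classification\<close>

text \<open>Each odd square is at least 1, so an all-odd tuple represents at least
  \<open>a + 3 * b\<close>.\<close>

lemma N_star_eq_0: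
  assumes "m < a + 3 * b"
  shows "N_star a b m = 0"
proof -
  have len: "int (length xs) \<le> (\<Sum>x\<leftarrow>xs. x\<^sup>2)" if "\<forall>x\<in>set xs. odd x" for xs :: "int list"
    using that
  proof (induction xs)
    case (Cons x xs)
    then have "x \<noteq> 0" by auto
    then have "1 \<le> x\<^sup>2" by (simp add: int_one_le_iff_zero_less)
    then show ?case using Cons by auto
  qed simp
  have "\<not> ((xs, ys) \<in> reps a b m \<and> (\<forall>x\<in>set xs. odd x) \<and> (\<forall>y\<in>set ys. odd y))" for xs ys
  proof
    assume *: "(xs, ys) \<in> reps a b m \<and> (\<forall>x\<in>set xs. odd x) \<and> (\<forall>y\<in>set ys. odd y)"
    then have "int m = (\<Sum>x\<leftarrow>xs. x\<^sup>2) + 3 * (\<Sum>y\<leftarrow>ys. y\<^sup>2)" "length xs = a" "length ys = b"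
      by (auto simp: reps_def sum_list_const_mult)
    then show False using * len[of xs] len[of ys] assms by linarith
  qed
  then have "{(xs, ys) \<in> reps a b m. (\<forall>x\<in>set xs. odd x) \<and> (\<forall>y\<in>set ys. odd y)} = {}" by blast
  then show ?thesis by (simp only: N_star_def card.empty)
qed

text \<open>At \<open>n = 0\<close> this forces any constant of proportionality to be
  nonzero.\<close>

lemma N_star_pos: "N_star a b (a + 3 * b) > 0"
proof -
  let ?S = "{(xs, ys) \<in> reps a b (a + 3 * b). (\<forall>x\<in>set xs. odd x) \<and> (\<forall>y\<in>set ys. odd y)}"
  have "(replicate a 1, replicate b 1) \<in> reps a b (a + 3 * b)"
    by (simp add: reps_def sum_list_replicate)
  then have "(replicate a 1, replicate b 1) \<in> ?S" by simp
  moreover have "finite ?S" by (rule finite_subset[OF _ finite_reps]) blast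
  ultimately have "card ?S > 0" unfolding card_gt_0_iff by blast
  then show ?thesis by (simp only: N_star_def)
qed

text \<open>\<open>G\<close> stands for the series of \<open>N_rep\<close> or
  \<open>N_tilde\<close>. On the residue class, the coefficients of \<open>O^a O'^b - C G\<close>
  vanish from \<open>a + 3 * b\<close> on by hypothesis, and below they are \<open>- C\<close> times
  those of \<open>G\<close>, because \<open>N_star\<close> is 0 there.\<close>

lemma low_coeff_eq_0_of_N_star:
  assumes "(a, b) \<noteq> (0, 0)" "proportional_near a b G" "\<And>m. G $ m = of_nat (c m)"
    and C: "\<And>n. of_nat (N_star a b (8 * n + a + 3 * b)) = (C :: rat) * of_nat (c (8 * n + a + 3 * b))"
    and m: "[m = a + 3 * b] (mod 8)" "m < a + 3 * b"
  shows "c m = 0"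
proof -
  let ?F = "theta odd 1 ^ a * theta odd 3 ^ b - fps_const (of_rat C) * G"
  have F: "?F $ m = of_nat (N_star a b m) - of_rat C * of_nat (c m)" for m
    by (simp add: N_star_eq_nth assms(3))
  have "C \<noteq> 0" using C[of 0] N_star_pos[of a b] by auto
  have "real (c m) = 0"
  proof (rule low_coeff_eq_0[OF assms(1), where F = ?F and C = "- of_rat C" and c = "\<lambda>m. real (c m)"])
    show "proportional_near a b ?F"
      by (intro proportional_near_diff proportional_near_theta_odd assms(2))
    show "?F $ m = 0" if m: "[m = a + 3 * b] (mod 8)" "m \<ge> a + 3 * b" for m
    proof -
      obtain n where "m = 8 * n + a + 3 * b"
        using cong_le_nat[OF m(2)] m(1) by (auto simp: algebra_simps)
      then have "of_rat (of_nat (N_star a b m)) = (of_rat (C * of_nat (c m)) :: complex)"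
        using C by simp
      then show ?thesis unfolding F by (simp add: of_rat_mult)
    qed
    show "?F $ m = - of_rat C * of_real (real (c m))" if "m < a + 3 * b" for m
      unfolding F using N_star_eq_0[OF that] by simp
  qed (use m \<open>C \<noteq> 0\<close> in auto)
  then show ?thesis by simp
qed

lemma low_N_rep_eq_0:
  assumes "(a, b) \<noteq> (0, 0)"
    and "\<exists>C :: rat. \<forall>n. of_nat (N_star a b (8 * n + a + 3 * b)) = C * of_nat (N_rep a b (8 * n + a + 3 * b))"
    and "[m = a + 3 * b] (mod 8)" "m < a + 3 * b"
  shows "N_rep a b m = 0"
proof -
  obtain C :: rat where
    "\<And>n. of_nat (N_star a b (8 * n + a + 3 * b)) = C * of_nat (N_rep a b (8 * n + a + 3 * b))"
    using assms(2) by blast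
  from low_coeff_eq_0_of_N_star[OF assms(1) proportional_near_theta_all _ this assms(3,4)]
  show ?thesis by (simp add: N_rep_eq_nth)
qed

lemma low_N_tilde_eq_0:
  assumes "(a, b) \<noteq> (0, 0)"
    and "\<exists>C :: rat. \<forall>n. of_nat (N_star a b (8 * n + a + 3 * b)) = C * of_nat (N_tilde a b (8 * n + a + 3 * b))"
    and "[m = a + 3 * b] (mod 8)" "m < a + 3 * b"
  shows "N_tilde a b m = 0"
proof -
  obtain C :: rat where
    C: "\<And>n. of_nat (N_star a b (8 * n + a + 3 * b)) = C * of_nat (N_tilde a b (8 * n + a + 3 * b))"
    using assms(2) by blast
  show ?thesis
  proof (rule low_coeff_eq_0_of_N_star[OF assms(1) _ _ C assms(3,4)])
    \<comment> \<open>The factor \<open>fps_const 1\<close> puts the series of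
      \<open>N_tilde\<close> into the form of \<open>proportional_near_diff\<close>.\<close>
    show "proportional_near a b (theta_all 1 ^ a * theta_all 3 ^ b -
        fps_const 1 * (theta even 1 ^ a * theta even 3 ^ b))"
      by (intro proportional_near_diff proportional_near_theta_all proportional_near_theta_even)
  qed (simp add: N_tilde_eq_nth)
qed

text \<open>The witnesses have \<open>i\<close> even \<open>x\<close>-entries and \<open>j\<close> even \<open>y\<close>-entries; their odd entries are 1
  and their even entries 0, except possibly for a single 2.\<close>

lemma small_representation:
  assumes ij: "i \<le> a" "j \<le> b" "[i = j] (mod 4)"
    and bad: "(i, j) \<notin> {(0, 0), (1, 1), (4, 0), (0, 4)}"
  obtains m xs ys where "[m = a + 3 * b] (mod 8)" "m < a + 3 * b" "(xs, ys) \<in> reps a b m"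
    "(i, j) \<noteq> (a, b) \<Longrightarrow> (\<exists>x\<in>set xs. odd x) \<or> (\<exists>y\<in>set ys. odd y)"
proof -
  define xs0 ys0 :: "int list" where "xs0 = replicate (a - i) 1" and "ys0 = replicate (b - j) 1"
  \<comment> \<open>The total contribution of the odd entries, all equal to 1; the even entries have
    to contribute \<open>i + 3 * j\<close> modulo 8, but less than that.\<close>
  define s where "s = a - i + 3 * (b - j)"
  have s: "a + 3 * b = s + (i + 3 * j)" using ij by (simp add: s_def)
  have odd: "(\<exists>x\<in>set (xs0 @ xs'). odd x) \<or> (\<exists>y\<in>set (ys0 @ ys'). odd y)"
    if "(i, j) \<noteq> (a, b)" for xs' ys'
    using that ij by (auto simp: xs0_def ys0_def)
  have cong: "[s + t = a + 3 * b] (mod 8)" if "[t = i + 3 * j] (mod 8)" for t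
    unfolding s using that by (simp only: cong_add_lcancel_nat)
  have "(i + 3 * j) mod 8 = 0 \<or> (i + 3 * j) mod 8 = 4"
  proof -
    have "[i + 3 * j = j + 3 * j] (mod 4)" using ij(3) by (rule cong_add) simp
    then have "(i + 3 * j) mod 4 = 0" by (simp add: cong_def)
    then have "4 dvd i + 3 * j" by (rule dvd_eq_mod_eq_0[THEN iffD2])
    then obtain t where t: "i + 3 * j = 4 * t" by (elim dvdE)
    have "4 * t mod 8 = 4 * (t mod 2)" using mult_mod_right[of 4 t 2] by simp
    moreover have "t mod 2 = 0 \<or> t mod 2 = 1" by auto
    ultimately show ?thesis unfolding t by auto
  qed
  \<comment> \<open>The even entries contribute 0 if all vanish, 4 if one x-entry is 2, and, when no
    x-entry is even, 12 by one y-entry 2.\<close>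
  then consider "(i + 3 * j) mod 8 = 0" | "(i + 3 * j) mod 8 = 4" "i > 0"
    | "(i + 3 * j) mod 8 = 4" "i = 0" by (metis gr0I)
  then show thesis
  proof cases
    case 1
    show thesis
    proof (rule that[of "s + 0"])
      show "[s + 0 = a + 3 * b] (mod 8)" using 1 by (intro cong) (simp add: cong_def)
      show "s + 0 < a + 3 * b" using bad s by auto
      show "(xs0 @ replicate i 0, ys0 @ replicate j 0) \<in> reps a b (s + 0)"
        using ij by (simp add: reps_def xs0_def ys0_def s_def sum_list_replicate)
    qed (rule odd)
  next
    case 2
    show thesis
    proof (rule that[of "s + 4"])
      show "[s + 4 = a + 3 * b] (mod 8)" using 2 by (intro cong) (simp add: cong_def)
      \<comment> \<open>With \<open>i > 0\<close>, the value 4 occurs only for the excluded pairs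
        \<open>(4, 0)\<close> and \<open>(1, 1)\<close>.\<close>
      have "i + 3 * j \<noteq> 4" using bad 2(2) by simp presburger
      moreover have "i + 3 * j \<ge> 4" using 2(1) mod_less_eq_dividend[of "i + 3 * j" 8] by simp
      ultimately show "s + 4 < a + 3 * b" using s by simp
      show "(xs0 @ 2 # replicate (i - 1) 0, ys0 @ replicate j 0) \<in> reps a b (s + 4)"
        using ij 2 by (simp add: reps_def xs0_def ys0_def s_def sum_list_replicate)
    qed (rule odd)
  next
    case 3
    show thesis
    proof (rule that[of "s + 12"])
      show "[s + 12 = a + 3 * b] (mod 8)" using 3 by (intro cong) (simp add: cong_def)
      \<comment> \<open>3 is invertible modulo 8. As \<open>j = 4\<close> is excluded,
        \<open>3 * j\<close> exceeds the contribution 12.\<close>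
      have "j mod 8 = 4" using 3 by presburger
      moreover have "j \<noteq> 4" using bad 3 by auto
      ultimately have "j > 4" by presburger
      then show "s + 12 < a + 3 * b" using s by simp
      show "(xs0 @ replicate i 0, ys0 @ 2 # replicate (j - 1) 0) \<in> reps a b (s + 12)"
        using ij 3 \<open>j > 4\<close> by (simp add: reps_def xs0_def ys0_def s_def sum_list_replicate)
    qed (rule odd)
  qed
qed

lemma N_star_proportional_N_rep_iff:
  assumes "(a, b) \<noteq> (0, 0)"
  shows "(\<exists>C :: rat. \<forall>n :: nat.
      of_nat (N_star a b (8 * n + a + 3 * b)) = C * of_nat (N_rep a b (8 * n + a + 3 * b))) \<longleftrightarrow>
    (\<forall>i j. i \<le> a \<longrightarrow> j \<le> b \<longrightarrow> [i = j] (mod 4) \<longrightarrow> (i, j) \<in> {(0, 0), (1, 1), (4, 0), (0, 4)})"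
    (is "?L \<longleftrightarrow> ?R")
proof
  assume L: ?L
  show ?R
  proof (intro allI impI, rule ccontr)
    fix i j assume "i \<le> a" "j \<le> b" "[i = j] (mod 4)" "(i, j) \<notin> {(0, 0), (1, 1), (4, 0), (0, 4)}"
    then obtain m xs ys where m: "[m = a + 3 * b] (mod 8)" "m < a + 3 * b" "(xs, ys) \<in> reps a b m"
      by (rule small_representation)
    then have "N_rep a b m > 0" using finite_reps by (auto simp: N_rep_def card_gt_0_iff)
    then show False using low_N_rep_eq_0[OF assms L m(1,2)] by simp
  qed
next
  assume ?R
  then show ?L by (intro N_star_proportional_N_rep) blast
qed

lemma N_star_proportional_N_tilde_iff:
  assumes "(a, b) \<noteq> (0, 0)"
  shows "(\<exists>C :: rat. \<forall>n :: nat.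
      of_nat (N_star a b (8 * n + a + 3 * b)) = C * of_nat (N_tilde a b (8 * n + a + 3 * b))) \<longleftrightarrow>
    (\<forall>i j. i \<le> a \<longrightarrow> j \<le> b \<longrightarrow> [i = j] (mod 4) \<longrightarrow>
      (i, j) \<in> {(0, 0), (1, 1), (4, 0), (0, 4), (a, b)})"
    (is "?L \<longleftrightarrow> ?R")
proof
  assume L: ?L
  show ?R
  proof (intro allI impI, rule ccontr)
    fix i j assume ij: "i \<le> a" "j \<le> b" "[i = j] (mod 4)"
      and bad: "(i, j) \<notin> {(0, 0), (1, 1), (4, 0), (0, 4), (a, b)}"
    have "(i, j) \<notin> {(0, 0), (1, 1), (4, 0), (0, 4)}" "(i, j) \<noteq> (a, b)" using bad by auto
    with ij obtain m xs ys where m: "[m = a + 3 * b] (mod 8)" "m < a + 3 * b"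
      and xy: "(xs, ys) \<in> reps a b m" "(\<exists>x\<in>set xs. odd x) \<or> (\<exists>y\<in>set ys. odd y)"
      by (metis small_representation)
    let ?S = "{(xs, ys) \<in> reps a b m. (\<exists>x\<in>set xs. odd x) \<or> (\<exists>y\<in>set ys. odd y)}"
    have "finite ?S" by (rule finite_subset[OF _ finite_reps]) blast
    moreover have "(xs, ys) \<in> ?S" using xy by blast
    ultimately have "card ?S > 0" unfolding card_gt_0_iff by blast
    then have "N_tilde a b m > 0" by (simp only: N_tilde_def)
    then show False using low_N_tilde_eq_0[OF assms L m] by simp
  qed
next
  assume R: ?R
  show ?L by (rule N_star_proportional_N_tilde[OF assms]) (use R in blast)
qed

section \<open>Pairs without further patterns\<close>

text \<open>The listed pairs have entries at most 8, so this turns the congruence into finitely many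
  linear cases.\<close>

lemma cong_4_cases:
  fixes i j :: nat
  assumes "[i = j] (mod 4)" "i \<le> 8" "j \<le> 8"
  shows "i = j \<or> i = j + 4 \<or> j = i + 4 \<or> i = j + 8 \<or> j = i + 8"
proof -
  have "v = u \<or> v = u + 4 \<or> v = u + 8" if uv: "[v = u] (mod 4)" "u \<le> v" "v \<le> 8" for u v :: nat
  proof -
    obtain q where q: "v = q * 4 + u" using cong_le_nat[OF uv(2)] uv(1) by blast
    then have "q = 0 \<or> q = 1 \<or> q = 2" using uv(3) by linarith
    then show ?thesis using q by auto
  qed
  from this[of i j] this[of j i] show ?thesis
    using assms cong_sym nat_le_linear by metis
qed

lemma patterns_rep_iff:
  fixes a b :: nat
  assumes "(a, b) \<noteq> (0, 0)" "(a + b) mod 2 = 0"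
  shows "(\<forall>i j. i \<le> a \<longrightarrow> j \<le> b \<longrightarrow> [i = j] (mod 4) \<longrightarrow>
      (i, j) \<in> {(0, 0), (1, 1), (4, 0), (0, 4)}) \<longleftrightarrow>
    (a, b) \<in> {(0,2), (0,4), (0,6), (1,1), (1,3), (2,0), (3,1), (4,0), (6,0)}"
proof (intro iffI allI impI)
  assume "\<forall>i j. i \<le> a \<longrightarrow> j \<le> b \<longrightarrow> [i = j] (mod 4) \<longrightarrow>
      (i, j) \<in> {(0, 0), (1, 1), (4, 0), (0, 4)}"
  note good = this[rule_format]
  \<comment> \<open>\<open>(8, 0)\<close>, \<open>(0, 8)\<close>, \<open>(2, 2)\<close>,
    \<open>(5, 1)\<close> and \<open>(1, 5)\<close> are the minimal forbidden patterns in the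
    componentwise order, so avoiding them is enough.\<close>
  have "\<not> 8 \<le> a" "\<not> 8 \<le> b" "\<not> (2 \<le> a \<and> 2 \<le> b)" "\<not> (5 \<le> a \<and> 1 \<le> b)" "\<not> (1 \<le> a \<and> 5 \<le> b)"
    using good[of 8 0] good[of 0 8] good[of 2 2] good[of 5 1] good[of 1 5]
    by (auto simp: cong_def)
  moreover have "a > 0 \<or> b > 0" using assms(1) by auto
  ultimately show "(a, b) \<in> {(0,2), (0,4), (0,6), (1,1), (1,3), (2,0), (3,1), (4,0), (6,0)}"
    using assms(2) by simp presburger
next
  fix i j assume ab: "(a, b) \<in> {(0,2), (0,4), (0,6), (1,1), (1,3), (2,0), (3,1), (4,0), (6,0)}"
    and ij: "i \<le> a" "j \<le> b" "[i = j] (mod 4)"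
  have "i \<le> 8" "j \<le> 8" using ab ij by auto
  with ij(3) have "i = j \<or> i = j + 4 \<or> j = i + 4 \<or> i = j + 8 \<or> j = i + 8" by (rule cong_4_cases)
  with ab ij(1,2) show "(i, j) \<in> {(0, 0), (1, 1), (4, 0), (0, 4)}"
    by (elim insertE emptyE disjE; simp; linarith)
qed

lemma patterns_tilde_iff:
  fixes a b :: nat
  assumes "(a, b) \<noteq> (0, 0)" "(a + 3 * b) mod 4 = 0"
  shows "(\<forall>i j. i \<le> a \<longrightarrow> j \<le> b \<longrightarrow> [i = j] (mod 4) \<longrightarrow>
      (i, j) \<in> {(0, 0), (1, 1), (4, 0), (0, 4), (a, b)}) \<longleftrightarrow>
    (a, b) \<in> {(0,4), (0,8), (1,1), (1,5), (2,2), (4,0), (5,1), (8,0)}"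
proof (intro iffI allI impI)
  assume "\<forall>i j. i \<le> a \<longrightarrow> j \<le> b \<longrightarrow> [i = j] (mod 4) \<longrightarrow>
      (i, j) \<in> {(0, 0), (1, 1), (4, 0), (0, 4), (a, b)}"
  note good = this[rule_format]
  \<comment> \<open>Each of the five minimal patterns may now occur only as \<open>(a, b)\<close>
    itself.\<close>
  have "8 \<le> a \<longrightarrow> a = 8 \<and> b = 0" "8 \<le> b \<longrightarrow> a = 0 \<and> b = 8"
    "2 \<le> a \<and> 2 \<le> b \<longrightarrow> a = 2 \<and> b = 2" "5 \<le> a \<and> 1 \<le> b \<longrightarrow> a = 5 \<and> b = 1"
    "1 \<le> a \<and> 5 \<le> b \<longrightarrow> a = 1 \<and> b = 5"
    using good[of 8 0] good[of 0 8] good[of 2 2] good[of 5 1] good[of 1 5]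
    by (auto simp: cong_def)
  moreover have "a > 0 \<or> b > 0" using assms(1) by auto
  ultimately show "(a, b) \<in> {(0,4), (0,8), (1,1), (1,5), (2,2), (4,0), (5,1), (8,0)}"
    using assms(2) by simp presburger
next
  fix i j assume ab: "(a, b) \<in> {(0,4), (0,8), (1,1), (1,5), (2,2), (4,0), (5,1), (8,0)}"
    and ij: "i \<le> a" "j \<le> b" "[i = j] (mod 4)"
  have "i \<le> 8" "j \<le> 8" using ab ij by auto
  with ij(3) have "i = j \<or> i = j + 4 \<or> j = i + 4 \<or> i = j + 8 \<or> j = i + 8" by (rule cong_4_cases)
  with ab ij(1,2) show "(i, j) \<in> {(0, 0), (1, 1), (4, 0), (0, 4), (a, b)}"
    by (elim insertE emptyE disjE; simp; linarith)
qed

theorem theorem1p1: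
  fixes a b :: nat
  assumes "(a, b) \<noteq> (0, 0)" and "(a + b) mod 2 = 0"
  shows "((\<exists>C :: rat. \<forall>n :: nat.
            of_nat (N_star a b (8 * n + a + 3 * b)) = C * of_nat (N_rep a b (8 * n + a + 3 * b)))
          \<longleftrightarrow> (a, b) \<in> {(0,2), (0,4), (0,6), (1,1), (1,3), (2,0), (3,1), (4,0), (6,0)})
       \<and> ((a + 3 * b) mod 4 = 0 \<longrightarrow>
          ((\<exists>C :: rat. \<forall>n :: nat.
            of_nat (N_star a b (8 * n + a + 3 * b)) = C * of_nat (N_tilde a b (8 * n + a + 3 * b)))
          \<longleftrightarrow> (a, b) \<in> {(0,4), (0,8), (1,1), (1,5), (2,2), (4,0), (5,1), (8,0)}))"
  using assms
  by (intro conjI impI) (simp_all only: N_star_proportional_N_rep_iff N_star_proportional_N_tilde_iff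
      patterns_rep_iff patterns_tilde_iff not_False_eq_True)

end
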